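(* Let $(w,u)$ be a fixed design for the controlled experiment described in the context, with observation blocks $y_1,\dots,y_M$ and parameter $\theta\sim p_0$. Then, for each $i\in\{1,\dots,M\}$, $$ I_{\mathrm{inst}}(\theta;y_i\mid w,u)-I(\theta;y_i\mid y_{1:i-1},w,u)=I(y_i;y_{1:i-1}\mid w,u)\;\ge\;0 . $$ As a consequence, $I(\theta;y_i\mid y_{1:i-1},w,u)\le I_{\mathrm{inst}}(\theta;y_i\mid w,u)$ for every $i\in\{1,\dots,M\}$, and $$ J_{\mathrm{EIG}}(w,u)\le J_{\mathrm{inst}}(w,u). $$
   Context: Dynamics: $x(t;u,\theta)\in\mathbb{R}^{n_x}$, $t\in[0,T]$, is the unique solution of $\dot x(t)=f(x(t),u(t),\theta,t)$, $x(0)=x_0$, where $u$ is a measurable control with values in a compact set $U\subset\mathbb{R}^{n_u}$ and $\theta\in\mathbb{R}^{n_\theta}$ is an unknown random parameter with prior density $p_0$. The function $f$ is assumed regular enough that existence and uniqueness hold for every such $u$ and $\theta$. Observations: there are candidate times $t_1,\dots,t_M\in[0,T]$ and $n_{\mathrm{exp}}$ sensors with observation functions $h_d:\mathbb{R}^{n_x}\to\mathbb{R}^{n_y}$. A (non-adaptive, deterministic) design is a pair $(w,u)$ with sampling weights $w=(w_{i,d})_{1\le i\le M,\,1\le d\le n_{\mathrm{exp}}}$, $w_{i,d}\in\{0,1\}$. If $w_{i,d}=1$, then $y_{i,d}=h_d(x(t_i;u,\theta))+\varepsilon_{i,d}$, where the $\varepsilon_{i,d}$ are mutually independent random variables, independent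 of $\theta$, with densities $p_{\varepsilon_{i,d}}$. If $w_{i,d}=0$, then $y_{i,d}=c$ deterministically, where $c\notin\mathbb{R}^{n_y}$ is a fixed "cemetery" value. Put $y_i=(y_{i,d})_{1\le d\le n_{\mathrm{exp}}}$ and $y_{1:i}=(y_1,\dots,y_i)$ ($y_{1:0}$ is empty, i.e. carries no information). Consequently $y_1,\dots,y_M$ are conditionally independent given $\theta$. Conditioning on $(w,u)$ is purely parametric: it only records the dependence of the laws on the design. $I(A;B\mid w,u)$ is the mutual information of $A$ and $B$ under the joint law induced by the design, and $I(A;B\mid C,w,u)$ is the conditional mutual information given $C$. All relevant densities are assumed to exist and all information-theoretic quantities considered are assumed to be well defined and finite. Definitions: - $I_{\mathrm{inst}}(\theta;y_i\mid w,u):=\mathbb{E}\bigl[\log p(y_i\mid\theta,w,u)-\log p(y_i\mid w,u)\bigr]$, the expectation being over $p_0(\theta)\,p(y_i\mid\theta,w,u)$, with $p(y_i\mid w,u)=\int p(y_i\mid\theta',w,u)\,p_0(\theta')\,d\theta'$; - $J_{\mathrm{inst}}(w,u):=\sum_{i=1}^M I_{\mathrm{inst}}(\theta;y_i\mid w,u)$; - $J_{\mathrm{EIG}}(w,u):=I(\theta;y_{1:M}\mid w,u)=\mathbb{E}\bigl[\log\frac{p(y\mid\theta,w,u)}{p(y\mid w,u)}\bigr]$ with $y=y_{1:M}$, the expectation being over $p_0(\theta)\,p(y\mid\theta,w,u)$. *)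

theory Defs
  imports "HOL-Probability.Probability"
begin

section \<open>Controlled dynamics\<close>

definition absolutely_continuous_on :: "real \<Rightarrow> real \<Rightarrow> (real \<Rightarrow> 'a::real_normed_vector) \<Rightarrow> bool" where
  "absolutely_continuous_on a b z \<longleftrightarrow>
     (\<forall>\<epsilon>>0. \<exists>\<delta>>0. \<forall>n (l :: nat \<Rightarrow> real) r.
        (\<forall>k<n. a \<le> l k \<and> l k \<le> r k \<and> r k \<le> b) \<longrightarrow>
        disjoint_family_on (\<lambda>k. {l k<..<r k}) {..<n} \<longrightarrow>
        (\<Sum>k<n. r k - l k) < \<delta> \<longrightarrow> (\<Sum>k<n. norm (z (r k) - z (l k))) < \<epsilon>)"

text \<open>Controls are only measurable in time, so solutions are understood in the sense of
  Caratheodory: absolutely continuous, with the differential equation holding almost everywhere.\<close>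

definition ode_solution ::
  "('x::euclidean_space \<Rightarrow> 'u \<Rightarrow> 'p \<Rightarrow> real \<Rightarrow> 'x) \<Rightarrow> 'x \<Rightarrow> real \<Rightarrow> (real \<Rightarrow> 'u) \<Rightarrow> 'p \<Rightarrow> (real \<Rightarrow> 'x) \<Rightarrow> bool"
where
  "ode_solution f x0 T v \<theta> z \<longleftrightarrow>
     absolutely_continuous_on 0 T z \<and> z 0 = x0 \<and>
     (AE s in lebesgue_on {0..T}.
        (z has_vector_derivative f (z s) (v s) \<theta> s) (at s within {0..T}))"

definition admissible_controls :: "real \<Rightarrow> 'u::euclidean_space set \<Rightarrow> (real \<Rightarrow> 'u) set" where
  "admissible_controls T U = {v \<in> borel_measurable (lebesgue_on {0..T}). \<forall>s\<in>{0..T}. v s \<in> U}"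


section \<open>Observation spaces\<close>

text \<open>An observation is \<open>Some v\<close> for an actual measurement \<open>v\<close> and \<open>None\<close> for the cemetery value.
  The reference measure for densities is Lebesgue measure on the actual measurements plus a unit
  point mass at the cemetery value.\<close>

definition cemetery_measure :: "'y::euclidean_space option measure" where
  "cemetery_measure =
     measure_of UNIV {A. Some -` A \<in> sets borel}
       (\<lambda>A. emeasure lborel (Some -` A) + indicator A None)"

lemma sigma_algebra_cemetery:
  "sigma_algebra UNIV {A :: 'y::euclidean_space option set. Some -` A \<in> sets borel}"
  by (rule sigma_algebra_iff2[THEN iffD2])
     (auto simp: vimage_Compl vimage_Diff Compl_eq_Diff_UNIV[symmetric] vimage_UN)

lemma space_cemetery_measure [simp]: "space cemetery_measure = UNIV"
  by (simp add: cemetery_measure_def space_measure_of_conv)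

lemma sets_cemetery_measure:
  "sets (cemetery_measure :: 'y::euclidean_space option measure) = {A. Some -` A \<in> sets borel}"
  unfolding cemetery_measure_def
  by (rule sigma_algebra.sets_measure_of_eq[OF sigma_algebra_cemetery])

lemma emeasure_cemetery_measure:
  assumes "A \<in> sets (cemetery_measure :: 'y::euclidean_space option measure)"
  shows "emeasure cemetery_measure A = emeasure lborel (Some -` A) + indicator A None"
proof -
  let ?S = "{A :: 'y option set. Some -` A \<in> sets borel}"
  let ?m = "\<lambda>A :: 'y option set. emeasure lborel (Some -` A) + indicator A None"
  have "countably_additive ?S ?m"
    unfolding countably_additive_def
  proof safe
    fix B :: "nat \<Rightarrow> 'y option set"
    assume B: "range B \<subseteq> ?S" "disjoint_family B"
    have d: "disjoint_family (\<lambda>i. Some -` B i)"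
      using B(2) unfolding disjoint_family_on_def by blast
    have "(\<Sum>i. ?m (B i)) =
        (\<Sum>i. emeasure lborel (Some -` B i)) + (\<Sum>i. indicator (B i) None)"
      by (rule suminf_add[symmetric]) auto
    also have "(\<Sum>i. emeasure lborel (Some -` B i)) = emeasure lborel (\<Union>i. Some -` B i)"
      using B(1) d by (intro suminf_emeasure) auto
    also have "(\<Sum>i. indicator (B i) None :: ennreal) = indicator (\<Union>i. B i) None"
      by (rule suminf_indicator[OF B(2)])
    finally show "(\<Sum>i. ?m (B i)) = ?m (\<Union>i. B i)"
      by (simp add: vimage_UN)
  qed
  moreover have "positive ?S ?m"
    by (simp add: positive_def)
  moreover have "A \<in> ?S"
    using assms by (simp add: sets_cemetery_measure)
  ultimately show ?thesis
    unfolding cemetery_measure_def by (intro emeasure_measure_of_sigma sigma_algebra_cemetery)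
qed

definition block_space :: "nat \<Rightarrow> (nat \<Rightarrow> 'y::euclidean_space option) measure" where
  "block_space n = (\<Pi>\<^sub>M d\<in>{1..n}. cemetery_measure)"

definition history_space :: "nat \<Rightarrow> nat \<Rightarrow> (nat \<Rightarrow> nat \<Rightarrow> 'y::euclidean_space option) measure" where
  "history_space n k = (\<Pi>\<^sub>M i\<in>{1..k}. block_space n)"

text \<open>From scalar observations \<open>y i d\<close>, as random variables on some \<open>'o\<close>: the block \<open>y\<^sub>i\<close> of
  all \<open>n\<close> sensors, and the history \<open>y\<^sub>1\<^sub>:\<^sub>k\<close>, which is a constant for \<open>k = 0\<close>.\<close>

definition block :: "nat \<Rightarrow> (nat \<Rightarrow> nat \<Rightarrow> 'o \<Rightarrow> 'y option) \<Rightarrow> nat \<Rightarrow> 'o \<Rightarrow> nat \<Rightarrow> 'y option" where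
  "block n y i \<omega> = (\<lambda>d\<in>{1..n}. y i d \<omega>)"

definition history :: "nat \<Rightarrow> (nat \<Rightarrow> nat \<Rightarrow> 'o \<Rightarrow> 'y option) \<Rightarrow> nat \<Rightarrow> 'o \<Rightarrow> nat \<Rightarrow> nat \<Rightarrow> 'y option" where
  "history n y k \<omega> = (\<lambda>i\<in>{1..k}. block n y i \<omega>)"


section \<open>Densities and information\<close>

text \<open>Density with respect to \<open>cemetery_measure\<close> of a single observation with sampling weight
  \<open>wt\<close>, where \<open>q\<close> is the density of the measurement in case it is taken.\<close>

definition observation_density :: "nat \<Rightarrow> ('y \<Rightarrow> real) \<Rightarrow> 'y option \<Rightarrow> real" where
  "observation_density wt q c =
     (if wt = 1 then (case c of Some v \<Rightarrow> q v | None \<Rightarrow> 0)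
      else (case c of Some v \<Rightarrow> 0 | None \<Rightarrow> 1))"

text \<open>The conditional density \<open>p(y\<^sub>i | \<theta>, w, u)\<close> with respect to \<open>block_space n\<close>: given \<open>\<theta>\<close>, a
  measurement is a translate of its noise, and the noises of different sensors are independent.\<close>

definition block_likelihood ::
  "nat \<Rightarrow> ((real \<Rightarrow> 'u) \<Rightarrow> 'p \<Rightarrow> real \<Rightarrow> 'x) \<Rightarrow> (nat \<Rightarrow> 'x \<Rightarrow> 'y::euclidean_space) \<Rightarrow> (nat \<Rightarrow> real) \<Rightarrow>
   (nat \<Rightarrow> nat \<Rightarrow> 'y \<Rightarrow> real) \<Rightarrow> (nat \<Rightarrow> nat \<Rightarrow> nat) \<Rightarrow> (real \<Rightarrow> 'u) \<Rightarrow> nat \<Rightarrow>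
   'p \<Rightarrow> (nat \<Rightarrow> 'y option) \<Rightarrow> real"
where
  "block_likelihood n x h t p_noise w u i \<theta> b =
     (\<Prod>d\<in>{1..n}. observation_density (w i d) (\<lambda>v. p_noise i d (v - h d (x u \<theta> (t i)))) (b d))"

text \<open>For a prior density \<open>p0\<close> and a likelihood \<open>L \<theta> b\<close> with respect to \<open>N\<close>: the law
  \<open>p0(\<theta>) L(\<theta>, b)\<close>, the log ratio of likelihood and evidence, and its expectation.\<close>

definition model_law ::
  "('p::euclidean_space \<Rightarrow> real) \<Rightarrow> 'b measure \<Rightarrow> ('p \<Rightarrow> 'b \<Rightarrow> real) \<Rightarrow> ('p \<times> 'b) measure"
where
  "model_law p0 N L = density (lborel \<Otimes>\<^sub>M N) (\<lambda>(\<theta>, b). ennreal (p0 \<theta> * L \<theta> b))"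

definition log_likelihood_ratio ::
  "('p::euclidean_space \<Rightarrow> real) \<Rightarrow> ('p \<Rightarrow> 'b \<Rightarrow> real) \<Rightarrow> 'p \<times> 'b \<Rightarrow> real"
where
  "log_likelihood_ratio p0 L = (\<lambda>(\<theta>, b). ln (L \<theta> b) - ln (\<integral>\<theta>'. L \<theta>' b * p0 \<theta>' \<partial>lborel))"

definition I_inst :: "('p::euclidean_space \<Rightarrow> real) \<Rightarrow> 'b measure \<Rightarrow> ('p \<Rightarrow> 'b \<Rightarrow> real) \<Rightarrow> real" where
  "I_inst p0 N L = integral\<^sup>L (model_law p0 N L) (log_likelihood_ratio p0 L)"

definition finite_I_inst :: "('p::euclidean_space \<Rightarrow> real) \<Rightarrow> 'b measure \<Rightarrow> ('p \<Rightarrow> 'b \<Rightarrow> real) \<Rightarrow> bool" where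
  "finite_I_inst p0 N L \<longleftrightarrow> integrable (model_law p0 N L) (log_likelihood_ratio p0 L)"

text \<open>The library's mutual information is a Bochner integral, which is \<open>0\<close> by convention when
  the true value is infinite; these predicates exclude that case.  The library's conditional
  mutual information of \<open>X\<close> and \<open>Y\<close> given \<open>Z\<close> is \<open>I(X; (Y, Z)) - I(X; Z)\<close>, so it is meaningful
  when both terms are finite.\<close>

definition finite_mutual_information ::
  "'o measure \<Rightarrow> 'a measure \<Rightarrow> 'b measure \<Rightarrow> ('o \<Rightarrow> 'a) \<Rightarrow> ('o \<Rightarrow> 'b) \<Rightarrow> bool"
where
  "finite_mutual_information P S T X Y \<longleftrightarrow>
     (let Q = distr P S X \<Otimes>\<^sub>M distr P T Y; R = distr P (S \<Otimes>\<^sub>M T) (\<lambda>\<omega>. (X \<omega>, Y \<omega>)) in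
        absolutely_continuous Q R \<and> integrable R (entropy_density (exp 1) Q R))"

definition finite_conditional_mutual_information ::
  "'o measure \<Rightarrow> 'a measure \<Rightarrow> 'b measure \<Rightarrow> 'c measure \<Rightarrow> ('o \<Rightarrow> 'a) \<Rightarrow> ('o \<Rightarrow> 'b) \<Rightarrow> ('o \<Rightarrow> 'c) \<Rightarrow> bool"
where
  "finite_conditional_mutual_information P S T V X Y Z \<longleftrightarrow>
     finite_mutual_information P S (T \<Otimes>\<^sub>M V) X (\<lambda>\<omega>. (Y \<omega>, Z \<omega>)) \<and>
     finite_mutual_information P S V X Z"

text \<open>Mutual informations in nats.\<close>

abbreviation mutual_info ::
  "'o measure \<Rightarrow> 'a measure \<Rightarrow> 'b measure \<Rightarrow> ('o \<Rightarrow> 'a) \<Rightarrow> ('o \<Rightarrow> 'b) \<Rightarrow> real"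
where
  "mutual_info P \<equiv> prob_space.mutual_information P (exp 1)"

abbreviation cond_mutual_info ::
  "'o measure \<Rightarrow> 'a measure \<Rightarrow> 'b measure \<Rightarrow> 'c measure \<Rightarrow> ('o \<Rightarrow> 'a) \<Rightarrow> ('o \<Rightarrow> 'b) \<Rightarrow> ('o \<Rightarrow> 'c) \<Rightarrow> real"
where
  "cond_mutual_info P \<equiv> prob_space.conditional_mutual_information P (exp 1)"

definition J_inst ::
  "('p::euclidean_space \<Rightarrow> real) \<Rightarrow> 'b measure \<Rightarrow> nat \<Rightarrow> (nat \<Rightarrow> 'p \<Rightarrow> 'b \<Rightarrow> real) \<Rightarrow> real"
where
  "J_inst p0 N M L = (\<Sum>i = 1..M. I_inst p0 N (L i))"

definition J_EIG ::
  "'o measure \<Rightarrow> nat \<Rightarrow> nat \<Rightarrow> ('o \<Rightarrow> 'p::euclidean_space) \<Rightarrow>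
   (nat \<Rightarrow> nat \<Rightarrow> 'o \<Rightarrow> 'y::euclidean_space option) \<Rightarrow> real"
where
  "J_EIG P n M \<theta> y = mutual_info P borel (history_space n M) \<theta> (history n y M)"

end

(* For an observation Y with conditional density L given theta, the mutual information of theta
   and Y is the expectation of ln L(theta, Y) - ln p(Y).  By conditional independence the likelihood
   of (y_i, y_{1:i-1}) factorises, so in I_inst(theta; y_i) + I(theta; y_{1:i-1}) -
   I(theta; (y_i, y_{1:i-1})) the likelihood terms cancel under the expectation.  What is left is
   the expected log ratio of the joint marginal density of (y_i, y_{1:i-1}) to the product of its
   marginals, which is I(y_i; y_{1:i-1}).  The bound on J_EIG follows from the chain rule, which
   telescopes because y_{1:i} and (y_i, y_{1:i-1}) give the same log-likelihood ratio pointwise.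
   The joint densities come from the laws for fixed theta, which are products of translated noise
   densities, mixed over the prior by independence of theta and the noise. *)
theory Submission
  imports Defs
begin

section \<open>Mutual information as an expected log-likelihood ratio\<close>

text \<open>The law of \<open>X\<close> is \<open>N\<close> weighted by \<open>f\<close>, so it
  gives no mass to the set where \<open>f\<close> is not positive. This keeps the arguments of the
  later logarithms positive.\<close>

lemma AE_distributed_pos:
  fixes f :: "'b \<Rightarrow> real"
  assumes "distributed M N X (\<lambda>x. ennreal (f x))"
  shows "AE \<omega> in M. 0 < f (X \<omega>)"
proof -
  note [measurable] = distributed_measurable[OF assms] distributed_borel_measurable[OF assms]
  have "AE x in distr M N X. 0 < ennreal (f x)"
    unfolding distributed_distr_eq_density[OF assms] by (subst AE_density) auto
  moreover have "{x \<in> space N. 0 < ennreal (f x)} \<in> sets N"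
    by measurable
  ultimately have "AE \<omega> in M. 0 < ennreal (f (X \<omega>))"
    by (subst (asm) AE_distr_iff) auto
  then show ?thesis
    by eventually_elim simp
qed

text \<open>Against the common reference \<open>S \<Otimes>\<^sub>M T\<close> the product law has
  density \<open>Px * Py\<close> and the joint law has density \<open>Pxy\<close>, so the quotient
  is the Radon-Nikodym derivative inside \<open>entropy_density\<close>. Stated along
  \<open>(X, Y)\<close> almost surely in \<open>P\<close>, it lets log ratios be compared
  pointwise.\<close>

lemma AE_entropy_density_eq_log_ratio:
  fixes Pxy :: "'b \<times> 'c \<Rightarrow> real"
  assumes P: "prob_space P" and S: "sigma_finite_measure S" and T: "sigma_finite_measure T"
    and X: "distributed P S X (\<lambda>x. ennreal (Px x))" "\<And>x. 0 \<le> Px x"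
    and Y: "distributed P T Y (\<lambda>y. ennreal (Py y))" "\<And>y. 0 \<le> Py y"
    and XY: "distributed P (S \<Otimes>\<^sub>M T) (\<lambda>\<omega>. (X \<omega>, Y \<omega>)) (\<lambda>z. ennreal (Pxy z))" "\<And>z. 0 \<le> Pxy z"
  shows "AE \<omega> in P. entropy_density (exp 1) (distr P S X \<Otimes>\<^sub>M distr P T Y)
      (distr P (S \<Otimes>\<^sub>M T) (\<lambda>\<omega>. (X \<omega>, Y \<omega>))) (X \<omega>, Y \<omega>)
    = ln (Pxy (X \<omega>, Y \<omega>) / (Px (X \<omega>) * Py (Y \<omega>)))"
proof -
  interpret prob_space P by fact
  interpret S: sigma_finite_measure S by fact
  interpret T: sigma_finite_measure T by fact
  interpret ST: pair_sigma_finite S T ..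
  note [measurable] = distributed_measurable[OF X(1)] distributed_measurable[OF Y(1)]
    distributed_real_measurable[OF X(2,1)] distributed_real_measurable[OF Y(2,1)]
    distributed_real_measurable[OF XY(2,1)]
  interpret X: prob_space "distr P S X" by (rule prob_space_distr) simp
  interpret Y: prob_space "distr P T Y" by (rule prob_space_distr) simp
  interpret XY: pair_prob_space "distr P S X" "distr P T Y" ..
  let ?Q = "distr P S X \<Otimes>\<^sub>M distr P T Y" and ?R = "distr P (S \<Otimes>\<^sub>M T) (\<lambda>\<omega>. (X \<omega>, Y \<omega>))"
  define f where "f = (\<lambda>z. Px (fst z) * Py (snd z))"
  have f [measurable]: "f \<in> borel_measurable (S \<Otimes>\<^sub>M T)" "\<And>z. 0 \<le> f z"
    using X(2) Y(2) by (auto simp: f_def)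
  have "?Q = density S Px \<Otimes>\<^sub>M density T Py"
    by (simp add: distributed_distr_eq_density[OF X(1)] distributed_distr_eq_density[OF Y(1)])
  also have "\<dots> = density (S \<Otimes>\<^sub>M T) (\<lambda>(x, y). ennreal (Px x) * ennreal (Py y))"
    by (rule pair_measure_density)
      (auto simp: distributed_distr_eq_density[OF Y(1), symmetric] Y.sigma_finite_measure_axioms T)
  also have "\<dots> = density (S \<Otimes>\<^sub>M T) (\<lambda>z. ennreal (f z))"
    by (auto intro!: density_cong simp: f_def X(2) Y(2) ennreal_mult)
  finally have Q: "?Q = density (S \<Otimes>\<^sub>M T) (\<lambda>z. ennreal (f z))" .
  \<comment> \<open>A joint density vanishes almost everywhere where one of its marginals does, so
    dividing by \<open>f\<close> loses no mass of the joint law.\<close>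
  have "AE z in S \<Otimes>\<^sub>M T. Px (fst z) = 0 \<longrightarrow> Pxy z = 0"
    by (rule subdensity_real[OF measurable_fst XY(1) X(1)]) (auto simp: X(2) XY(2))
  moreover have "AE z in S \<Otimes>\<^sub>M T. Py (snd z) = 0 \<longrightarrow> Pxy z = 0"
    by (rule subdensity_real[OF measurable_snd XY(1) Y(1)]) (auto simp: Y(2) XY(2))
  ultimately have ac: "AE z in S \<Otimes>\<^sub>M T. f z = 0 \<longrightarrow> Pxy z = 0"
    by (auto simp: f_def)
  have "?R = density (S \<Otimes>\<^sub>M T) (\<lambda>z. ennreal (Pxy z))"
    by (rule distributed_distr_eq_density[OF XY(1)])
  also have "\<dots> = density ?Q (\<lambda>z. Pxy z / f z)"
    unfolding Q by (rule density_density_divide[symmetric]) (use ac XY(2) f in auto)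
  finally have R: "density ?Q (\<lambda>z. Pxy z / f z) = ?R" ..
  have "AE z in ?Q. ennreal (Pxy z / f z) = RN_deriv ?Q ?R z"
    by (rule XY.RN_deriv_unique) (auto simp: R)
  \<comment> \<open>A \<open>?Q\<close>-null set is \<open>?R\<close>-null, since \<open>?R\<close>
    has a density with respect to \<open>?Q\<close>.\<close>
  then have "AE z in ?R. ennreal (Pxy z / f z) = RN_deriv ?Q ?R z"
    by (subst R[symmetric], subst AE_density) (auto elim: eventually_mono)
  then have "AE z in ?R. enn2real (RN_deriv ?Q ?R z) = Pxy z / f z"
    by eventually_elim (metis XY(2) enn2real_ennreal f(2) divide_nonneg_nonneg)
  then have "AE z in ?R. entropy_density (exp 1) ?Q ?R z = ln (Pxy z / f z)"
    by eventually_elim (simp add: entropy_density_def log_def)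
  moreover have "entropy_density (exp 1) ?Q ?R \<in> borel_measurable ?Q"
    by measurable
  then have [measurable]: "entropy_density (exp 1) ?Q ?R \<in> borel_measurable (S \<Otimes>\<^sub>M T)"
    by (simp cong: measurable_cong_sets)
  have "{z \<in> space (S \<Otimes>\<^sub>M T). entropy_density (exp 1) ?Q ?R z = ln (Pxy z / f z)} \<in> sets (S \<Otimes>\<^sub>M T)"
    by measurable
  ultimately show ?thesis
    by (subst (asm) AE_distr_iff) (auto simp: f_def)
qed

text \<open>Transporting the log ratio to \<open>P\<close> along \<open>(X, Y)\<close> puts the
  mutual informations of different pairs under one integral. The first equation asks for no
  finiteness: the integrands agree almost surely, so their Bochner integrals agree even at the
  default value \<open>0\<close>.\<close>

lemma
  fixes Pxy :: "'b \<times> 'c \<Rightarrow> real"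
  assumes P: "prob_space P" and S: "sigma_finite_measure S" and T: "sigma_finite_measure T"
    and X: "distributed P S X (\<lambda>x. ennreal (Px x))" "\<And>x. 0 \<le> Px x"
    and Y: "distributed P T Y (\<lambda>y. ennreal (Py y))" "\<And>y. 0 \<le> Py y"
    and XY: "distributed P (S \<Otimes>\<^sub>M T) (\<lambda>\<omega>. (X \<omega>, Y \<omega>)) (\<lambda>z. ennreal (Pxy z))" "\<And>z. 0 \<le> Pxy z"
  defines "g \<equiv> \<lambda>\<omega>. ln (Pxy (X \<omega>, Y \<omega>) / (Px (X \<omega>) * Py (Y \<omega>)))"
  shows mutual_info_eq_expectation: "mutual_info P S T X Y = integral\<^sup>L P g"
    and integrable_log_ratio: "finite_mutual_information P S T X Y \<Longrightarrow> integrable P g"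
    and mutual_info_nonneg: "finite_mutual_information P S T X Y \<Longrightarrow> 0 \<le> mutual_info P S T X Y"
proof -
  interpret information_space P "exp 1"
    by (intro information_space.intro P) (unfold_locales, simp)
  note [measurable] = distributed_measurable[OF X(1)] distributed_measurable[OF Y(1)]
    distributed_real_measurable[OF X(2,1)] distributed_real_measurable[OF Y(2,1)]
    distributed_real_measurable[OF XY(2,1)]
  let ?Q = "distr P S X \<Otimes>\<^sub>M distr P T Y" and ?R = "distr P (S \<Otimes>\<^sub>M T) (\<lambda>\<omega>. (X \<omega>, Y \<omega>))"
  have g [measurable]: "g \<in> borel_measurable P"
    unfolding g_def by measurable
  have "entropy_density (exp 1) ?Q ?R \<in> borel_measurable ?Q"
    by measurable
  then have e [measurable]: "entropy_density (exp 1) ?Q ?R \<in> borel_measurable (S \<Otimes>\<^sub>M T)"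
    by (simp cong: measurable_cong_sets)
  have ae: "AE \<omega> in P. entropy_density (exp 1) ?Q ?R (X \<omega>, Y \<omega>) = g \<omega>"
    using AE_entropy_density_eq_log_ratio[OF P S T X Y XY] by (simp add: g_def)
  have "mutual_info P S T X Y = (\<integral>\<omega>. entropy_density (exp 1) ?Q ?R (X \<omega>, Y \<omega>) \<partial>P)"
    unfolding mutual_information_def KL_divergence_def by (rule integral_distr) auto
  also have "\<dots> = integral\<^sup>L P g"
    by (rule integral_cong_AE) (use ae in auto)
  finally show "mutual_info P S T X Y = integral\<^sup>L P g" .
  assume "finite_mutual_information P S T X Y"
  then have "integrable P (\<lambda>\<omega>. entropy_density (exp 1) ?Q ?R (X \<omega>, Y \<omega>))"
    by (auto simp: finite_mutual_information_def Let_def integrable_distr_eq)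
  then show int: "integrable P g"
    using g ae by (rule integrable_cong_AE_imp)
  show "0 \<le> mutual_info P S T X Y"
  proof (rule mutual_information_nonneg[OF S T X Y XY])
    \<comment> \<open>Weighting by \<open>Pxy\<close> turns integration over the reference measure
      into expectation under \<open>P\<close>, where integrability is already known.\<close>
    show "integrable (S \<Otimes>\<^sub>M T) (\<lambda>z. Pxy z * log (exp 1) (Pxy z / (Px (fst z) * Py (snd z))))"
      by (subst distributed_integrable[OF XY(1)]) (use int XY(2) in \<open>auto simp: g_def log_def\<close>)
  qed
qed

section \<open>Bayesian observation models\<close>

definition evidence :: "('p::euclidean_space \<Rightarrow> real) \<Rightarrow> ('p \<Rightarrow> 'b \<Rightarrow> real) \<Rightarrow> 'b \<Rightarrow> real" where
  "evidence p0 L b = (\<integral>a. L a b * p0 a \<partial>lborel)"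

text \<open>The conditional density \<open>L\<close> of \<open>Y\<close> given \<open>X\<close> is
  specified through the joint law instead of a kernel, so one predicate serves blocks, histories and
  pairs of both.\<close>

definition observes ::
  "'o measure \<Rightarrow> ('p::euclidean_space \<Rightarrow> real) \<Rightarrow> ('o \<Rightarrow> 'p) \<Rightarrow> 'b measure \<Rightarrow> ('p \<Rightarrow> 'b \<Rightarrow> real) \<Rightarrow> ('o \<Rightarrow> 'b) \<Rightarrow> bool"
where
  "observes P p0 X N L Y \<longleftrightarrow> sigma_finite_measure N \<and> (\<forall>a b. 0 \<le> L a b) \<and>
     (\<lambda>(a, b). L a b) \<in> borel_measurable (lborel \<Otimes>\<^sub>M N) \<and>
     distributed P (lborel \<Otimes>\<^sub>M N) (\<lambda>\<omega>. (X \<omega>, Y \<omega>)) (\<lambda>(a, b). ennreal (p0 a * L a b))"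

lemma log_likelihood_ratio_eq:
  "log_likelihood_ratio p0 L = (\<lambda>(a, b). ln (L a b) - ln (evidence p0 L b))"
  by (simp add: log_likelihood_ratio_def evidence_def)

locale bayes_prior = prob_space P for P :: "'o measure" +
  fixes p0 :: "'p::euclidean_space \<Rightarrow> real" and X :: "'o \<Rightarrow> 'p"
  assumes p0_nonneg: "0 \<le> p0 a"
    and X: "distributed P lborel X (\<lambda>a. ennreal (p0 a))"
begin

lemma p0_measurable [measurable]: "p0 \<in> borel_measurable borel"
  using distributed_real_measurable[OF p0_nonneg X] by simp

text \<open>\<open>borel\<close> and \<open>lborel\<close> have the same measurable sets, and
  pushing a law forward uses nothing else of its target. Densities need \<open>lborel\<close>, while
  the informations to be bounded are taken over \<open>borel\<close>.\<close>

lemma mutual_info_borel: "mutual_info P borel T X Y = mutual_info P lborel T X Y"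
  and finite_mutual_information_borel:
    "finite_mutual_information P borel T X Y = finite_mutual_information P lborel T X Y"
proof -
  have "distr P borel X = distr P lborel X"
    by (rule distr_cong) auto
  moreover have "distr P (borel \<Otimes>\<^sub>M T) (\<lambda>\<omega>. (X \<omega>, Y \<omega>)) = distr P (lborel \<Otimes>\<^sub>M T) (\<lambda>\<omega>. (X \<omega>, Y \<omega>))"
    by (rule distr_cong) (auto intro!: sets_pair_measure_cong)
  ultimately show "mutual_info P borel T X Y = mutual_info P lborel T X Y"
    "finite_mutual_information P borel T X Y = finite_mutual_information P lborel T X Y"
    by (simp_all add: mutual_information_def finite_mutual_information_def)
qed

context
  fixes N :: "'b measure" and L and Y
  assumes obs: "observes P p0 X N L Y"
begin

lemma observes_joint:
  "distributed P (lborel \<Otimes>\<^sub>M N) (\<lambda>\<omega>. (X \<omega>, Y \<omega>)) (\<lambda>z. ennreal (case z of (a, b) \<Rightarrow> p0 a * L a b))"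
  using obs by (simp add: observes_def case_prod_beta')

lemma observes_measurable:
  "Y \<in> measurable P N" "X \<in> borel_measurable P"
  "(\<lambda>(a, b). L a b) \<in> borel_measurable (borel \<Otimes>\<^sub>M N)"
proof -
  note [measurable] = distributed_measurable[OF observes_joint]
  have "(\<lambda>\<omega>. snd (X \<omega>, Y \<omega>)) \<in> measurable P N" "(\<lambda>\<omega>. fst (X \<omega>, Y \<omega>)) \<in> measurable P lborel"
    by measurable
  then show "Y \<in> measurable P N" "X \<in> borel_measurable P"
    by simp_all
  have "sets (borel \<Otimes>\<^sub>M N) = sets (lborel \<Otimes>\<^sub>M N)"
    by (rule sets_pair_measure_cong) simp_all
  then show "(\<lambda>(a, b). L a b) \<in> borel_measurable (borel \<Otimes>\<^sub>M N)"
    using obs by (simp add: observes_def cong: measurable_cong_sets)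
qed

lemma evidence_nonneg: "0 \<le> evidence p0 L b"
  using obs p0_nonneg unfolding evidence_def observes_def
  by (intro Bochner_Integration.integral_nonneg) auto

lemma evidence_measurable: "evidence p0 L \<in> borel_measurable N"
proof -
  note [measurable] = observes_measurable
  have "(\<lambda>(b, a). L a b * p0 a) \<in> borel_measurable (N \<Otimes>\<^sub>M lborel)"
    by measurable
  then show ?thesis
    unfolding evidence_def[abs_def] by (rule lborel.borel_measurable_lebesgue_integral)
qed

text \<open>Marginalising the joint density gives a nonnegative integral in \<open>ennreal\<close>,
  whereas \<open>evidence\<close> is a Bochner integral, which is \<open>0\<close> where the former
  is infinite. The two agree almost everywhere because the marginal has total mass one.\<close>

lemma distributed_evidence: "distributed P N Y (\<lambda>b. ennreal (evidence p0 L b))"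
proof -
  have N: "sigma_finite_measure N" and L: "\<And>a b. 0 \<le> L a b"
    using obs by (simp_all add: observes_def)
  let ?q = "\<lambda>b. \<integral>\<^sup>+a. ennreal (p0 a * L a b) \<partial>lborel"
  have q: "distributed P N Y ?q"
    using distr_marginal2[OF lborel.sigma_finite_measure_axioms N observes_joint] by simp
  note [measurable] = distributed_borel_measurable[OF q] evidence_measurable
  have "(\<integral>\<^sup>+b. ?q b \<partial>N) = 1"
    using distributed_nn_integral[OF q, of "\<lambda>_. 1"] by (simp add: emeasure_space_1)
  then have "AE b in N. ?q b \<noteq> \<infinity>"
    by (intro nn_integral_PInf_AE) auto
  then have "AE b in N. ?q b = ennreal (evidence p0 L b)"
  proof (rule AE_mp[OF _ AE_I2], intro impI)
    fix b assume b: "b \<in> space N" "?q b \<noteq> \<infinity>"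
    have [measurable]: "(\<lambda>a. L a b) \<in> borel_measurable borel"
      using measurable_compose[OF measurable_Pair2'[OF b(1), of borel] observes_measurable(3)] by simp
    have "integrable lborel (\<lambda>a. p0 a * L a b)"
      using b L p0_nonneg by (intro integrableI_nonneg) (auto simp: top.not_eq_extremum)
    then show "?q b = ennreal (evidence p0 L b)"
      using L p0_nonneg unfolding evidence_def
      by (subst nn_integral_eq_integral) (auto simp: mult.commute)
  qed
  then show ?thesis
    using q by (subst distributed_cong_density[where g = ?q]) (auto elim: eventually_mono)
qed

text \<open>Positivity of the product \<open>p0 * L\<close> passes to \<open>L\<close> because
  \<open>p0\<close> is positive too. With all three factors positive, \<open>ln_div\<close> and
  \<open>ln_mult\<close> apply almost surely.\<close>

lemma AE_observes_pos:
  "AE \<omega> in P. 0 < p0 (X \<omega>) \<and> 0 < L (X \<omega>) (Y \<omega>) \<and> 0 < evidence p0 L (Y \<omega>)"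
  using AE_distributed_pos[OF X] AE_distributed_pos[OF observes_joint]
    AE_distributed_pos[OF distributed_evidence]
  by eventually_elim (auto simp: zero_less_mult_iff)

lemma llr_measurable:
  "log_likelihood_ratio p0 L \<in> borel_measurable (lborel \<Otimes>\<^sub>M N)"
proof -
  note [measurable] = observes_measurable evidence_measurable
  show ?thesis
    unfolding log_likelihood_ratio_eq by measurable
qed

text \<open>In the ratio of the joint density \<open>p0 * L\<close> to the product of the marginals
  \<open>p0\<close> and \<open>evidence\<close>, the prior cancels and leaves likelihood over
  evidence.\<close>

lemma
  shows mutual_info_eq_llr:
      "mutual_info P borel N X Y = (\<integral>\<omega>. log_likelihood_ratio p0 L (X \<omega>, Y \<omega>) \<partial>P)"
    and integrable_llr_mutual_info: "finite_mutual_information P borel N X Y \<Longrightarrow>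
      integrable P (\<lambda>\<omega>. log_likelihood_ratio p0 L (X \<omega>, Y \<omega>))"
proof -
  have N: "sigma_finite_measure N" and L: "\<And>a b. 0 \<le> L a b"
    using obs by (simp_all add: observes_def)
  note [measurable] = observes_measurable evidence_measurable llr_measurable
  let ?g = "\<lambda>\<omega>. ln ((case (X \<omega>, Y \<omega>) of (a, b) \<Rightarrow> p0 a * L a b) / (p0 (X \<omega>) * evidence p0 L (Y \<omega>)))"
  have ae: "AE \<omega> in P. ?g \<omega> = log_likelihood_ratio p0 L (X \<omega>, Y \<omega>)"
    using AE_observes_pos by eventually_elim (simp add: log_likelihood_ratio_eq ln_div)
  have [measurable]: "?g \<in> borel_measurable P"
    by simp measurable
  have m [measurable]: "(\<lambda>\<omega>. log_likelihood_ratio p0 L (X \<omega>, Y \<omega>)) \<in> borel_measurable P"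
    by measurable
  note mi = prob_space_axioms lborel.sigma_finite_measure_axioms N X p0_nonneg
    distributed_evidence evidence_nonneg observes_joint
  show "mutual_info P borel N X Y = (\<integral>\<omega>. log_likelihood_ratio p0 L (X \<omega>, Y \<omega>) \<partial>P)"
    using mutual_info_eq_expectation[OF mi] integral_cong_AE[OF _ m ae] L p0_nonneg
    by (simp add: mutual_info_borel case_prod_beta')
  assume "finite_mutual_information P borel N X Y"
  then have "integrable P ?g"
    using integrable_log_ratio[OF mi] L p0_nonneg
    by (simp add: finite_mutual_information_borel case_prod_beta')
  then show "integrable P (\<lambda>\<omega>. log_likelihood_ratio p0 L (X \<omega>, Y \<omega>))"
    using ae by (rule integrable_cong_AE_imp[OF _ m])
qed

text \<open>\<open>model_law\<close> is the joint law of \<open>(X, Y)\<close>, so this is a change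
  of variables. By the preceding identity \<open>I_inst\<close> is thus the mutual information of
  \<open>X\<close> and \<open>Y\<close>.\<close>

lemma
  shows I_inst_eq_llr: "I_inst p0 N L = (\<integral>\<omega>. log_likelihood_ratio p0 L (X \<omega>, Y \<omega>) \<partial>P)"
    and integrable_llr_I_inst: "finite_I_inst p0 N L \<Longrightarrow>
      integrable P (\<lambda>\<omega>. log_likelihood_ratio p0 L (X \<omega>, Y \<omega>))"
proof -
  note [measurable] = observes_measurable llr_measurable
  have *: "model_law p0 N L = distr P (lborel \<Otimes>\<^sub>M N) (\<lambda>\<omega>. (X \<omega>, Y \<omega>))"
    using distributed_distr_eq_density[OF observes_joint] by (simp add: model_law_def case_prod_beta')
  show "I_inst p0 N L = (\<integral>\<omega>. log_likelihood_ratio p0 L (X \<omega>, Y \<omega>) \<partial>P)"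
    unfolding I_inst_def * by (rule integral_distr) auto
  show "finite_I_inst p0 N L \<Longrightarrow> integrable P (\<lambda>\<omega>. log_likelihood_ratio p0 L (X \<omega>, Y \<omega>))"
    unfolding finite_I_inst_def * by (subst (asm) integrable_distr_eq) auto
qed

end

section \<open>The information gap of an observation given the past\<close>

lemma I_inst_minus_cond_mutual_info:
  assumes Y: "observes P p0 X N L Y" and Z: "observes P p0 X H K Z"
    and YZ: "observes P p0 X (N \<Otimes>\<^sub>M H) (\<lambda>a (b, c). L a b * K a c) (\<lambda>\<omega>. (Y \<omega>, Z \<omega>))"
    and fin: "finite_I_inst p0 N L" "finite_mutual_information P N H Y Z"
      "finite_conditional_mutual_information P borel N H X Y Z"
  shows "I_inst p0 N L - cond_mutual_info P borel N H X Y Z = mutual_info P N H Y Z"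
    and "0 \<le> mutual_info P N H Y Z"
proof -
  let ?J = "\<lambda>a (b, c). L a b * K a c"
  note i = integrable_llr_I_inst[OF Y fin(1)]
    integrable_llr_mutual_info[OF Z] integrable_llr_mutual_info[OF YZ]
  have N: "sigma_finite_measure N" and H: "sigma_finite_measure H"
    using Y Z by (simp_all add: observes_def)
  note mi = prob_space_axioms N H distributed_evidence[OF Y] evidence_nonneg[OF Y]
    distributed_evidence[OF Z] evidence_nonneg[OF Z] distributed_evidence[OF YZ] evidence_nonneg[OF YZ]
  note [measurable] = observes_measurable[OF Y] observes_measurable[OF Z] observes_measurable[OF YZ]
    llr_measurable[OF Y] llr_measurable[OF Z] llr_measurable[OF YZ]
    evidence_measurable[OF Y] evidence_measurable[OF Z] evidence_measurable[OF YZ]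
  have "mutual_info P N H Y Z = (\<integral>\<omega>. ln (evidence p0 ?J (Y \<omega>, Z \<omega>) / (evidence p0 L (Y \<omega>) * evidence p0 K (Z \<omega>))) \<partial>P)"
    by (rule mutual_info_eq_expectation[OF mi])
  \<comment> \<open>Conditional independence is used here: the likelihood \<open>?J\<close> of the
    pair is the product of \<open>L\<close> and \<open>K\<close>, so the logarithms of the
    likelihoods cancel and only those of the three evidences remain.\<close>
  also have "\<dots> = (\<integral>\<omega>. log_likelihood_ratio p0 L (X \<omega>, Y \<omega>) -
      (log_likelihood_ratio p0 ?J (X \<omega>, (Y \<omega>, Z \<omega>)) - log_likelihood_ratio p0 K (X \<omega>, Z \<omega>)) \<partial>P)"
  proof (rule integral_cong_AE)
    show "AE \<omega> in P. ln (evidence p0 ?J (Y \<omega>, Z \<omega>) / (evidence p0 L (Y \<omega>) * evidence p0 K (Z \<omega>))) =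
       log_likelihood_ratio p0 L (X \<omega>, Y \<omega>) -
      (log_likelihood_ratio p0 ?J (X \<omega>, (Y \<omega>, Z \<omega>)) - log_likelihood_ratio p0 K (X \<omega>, Z \<omega>))"
      using AE_observes_pos[OF Y] AE_observes_pos[OF Z] AE_observes_pos[OF YZ]
      by eventually_elim (simp add: log_likelihood_ratio_eq ln_div ln_mult)
  qed measurable
  \<comment> \<open>Splitting the integral needs three integrable log ratios:
    \<open>finite_I_inst\<close> supplies the one for \<open>L\<close>, and the two halves of
    \<open>finite_conditional_mutual_information\<close> those for the pair and for
    \<open>K\<close>.\<close>
  also have "\<dots> = I_inst p0 N L - cond_mutual_info P borel N H X Y Z"
    using fin i by (simp add: finite_conditional_mutual_information_def conditional_mutual_information_def
      I_inst_eq_llr[OF Y] mutual_info_eq_llr[OF Z] mutual_info_eq_llr[OF YZ])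
  finally show "I_inst p0 N L - cond_mutual_info P borel N H X Y Z = mutual_info P N H Y Z" ..
  show "0 \<le> mutual_info P N H Y Z"
    by (rule mutual_info_nonneg[OF mi fin(2)])
qed

end

section \<open>Densities of observations\<close>

lemma Some_measurable [measurable]:
  "Some \<in> measurable borel (cemetery_measure :: 'y::euclidean_space option measure)"
  by (rule measurableI) (auto simp: sets_cemetery_measure)

lemma singleton_None_in_sets [measurable]: "{None} \<in> sets cemetery_measure"
  by (auto simp: sets_cemetery_measure vimage_def)

lemma range_Some_in_sets [measurable]: "range Some \<in> sets cemetery_measure"
  by (simp add: sets_cemetery_measure inj_vimage_image_eq)

lemma the_measurable [measurable]: "the \<in> borel_measurable cemetery_measure"
  by (rule measurableI) (auto simp: sets_cemetery_measure vimage_def)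

lemma sigma_finite_cemetery_measure:
  "sigma_finite_measure (cemetery_measure :: 'y::euclidean_space option measure)"
proof
  obtain A :: "'y set set" where A: "countable A" "A \<subseteq> sets lborel" "\<Union>A = space lborel"
    "\<forall>a\<in>A. emeasure lborel a \<noteq> \<infinity>"
    using lborel.sigma_finite_countable by blast
  \<comment> \<open>A countable cover of Euclidean space by sets of finite Lebesgue measure, moved
    by \<open>Some\<close>; the added set \<open>{None}\<close> has mass \<open>1\<close>.\<close>
  let ?B = "insert {None} ((`) Some ` A)"
  have [simp]: "Some -` Some ` a = a" for a :: "'y set"
    by auto
  have [simp]: "Some -` {None} = {}"
    by auto
  have S: "Some ` a \<in> sets cemetery_measure" if "a \<in> A" for a
    using that A(2) by (auto simp: sets_cemetery_measure)
  have "\<Union>?B = insert None (Some ` \<Union>A)"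
    by auto
  also have "\<dots> = UNIV"
    using A(3) by (auto simp: UNIV_option_conv)
  finally have "\<Union>?B = UNIV" .
  moreover have "emeasure cemetery_measure b \<noteq> \<infinity>" if "b \<in> ?B" for b
    using that A(4) S by (auto simp: emeasure_cemetery_measure)
  ultimately show "\<exists>A. countable A \<and> A \<subseteq> sets (cemetery_measure :: 'y option measure) \<and>
      \<Union>A = space cemetery_measure \<and> (\<forall>a\<in>A. emeasure cemetery_measure a \<noteq> \<infinity>)"
    using A(1) S by (intro exI[of _ ?B]) auto
qed

lemma product_sigma_finite_const:
  "sigma_finite_measure N \<Longrightarrow> product_sigma_finite (\<lambda>_. N)"
  by (simp add: product_sigma_finite_def)

lemma sigma_finite_block_space: "sigma_finite_measure (block_space n)"
  unfolding block_space_def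
  by (intro product_sigma_finite.sigma_finite product_sigma_finite_const sigma_finite_cemetery_measure) simp

lemma sigma_finite_history_space: "sigma_finite_measure (history_space n k)"
  unfolding history_space_def
  by (intro product_sigma_finite.sigma_finite product_sigma_finite_const sigma_finite_block_space) simp

text \<open>Together with the next lemma this splits \<open>cemetery_measure\<close> into the image
  of Lebesgue measure under \<open>Some\<close> and a unit point mass at \<open>None\<close>. A
  sampled observation lives on the first part, an unsampled one on the second.\<close>

lemma density_cemetery_measure_range_Some:
  "density cemetery_measure (indicator (range Some)) = distr lborel cemetery_measure Some"
proof (rule measure_eqI)
  fix A :: "'a option set"
  assume "A \<in> sets (density cemetery_measure (indicator (range Some)))"
  then have [measurable]: "A \<in> sets cemetery_measure"
    by simp
  have "Some -` (range Some \<inter> A) = Some -` A"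
    by auto
  then show "emeasure (density cemetery_measure (indicator (range Some))) A =
      emeasure (distr lborel cemetery_measure Some) A"
    by (simp add: emeasure_density emeasure_distr emeasure_cemetery_measure
        flip: indicator_inter_arith)
qed simp

lemma density_cemetery_measure_None:
  "density cemetery_measure (indicator {None}) = return cemetery_measure None"
proof (rule measure_eqI)
  fix A :: "'a option set"
  assume "A \<in> sets (density cemetery_measure (indicator {None}))"
  then have [measurable]: "A \<in> sets cemetery_measure"
    by simp
  have "Some -` ({None} \<inter> A) = {}"
    by auto
  then show "emeasure (density cemetery_measure (indicator {None})) A =
      emeasure (return cemetery_measure None) A"
    by (simp add: emeasure_density emeasure_cemetery_measure flip: indicator_inter_arith)
      (simp add: indicator_def)
qed simp

section \<open>The density of a single observation\<close>

lemma observation_density_measurable: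
  fixes q :: "'y::euclidean_space \<Rightarrow> real"
  assumes [measurable]: "q \<in> borel_measurable borel" "wt = 1 \<Longrightarrow> g \<in> borel_measurable borel"
  shows "(\<lambda>(a, c). observation_density wt (\<lambda>v. q (v - g a)) c)
    \<in> borel_measurable (borel \<Otimes>\<^sub>M cemetery_measure)"
proof -
  \<comment> \<open>Replaces the case distinction by measurable operations: \<open>the\<close> is
    measurable on all of \<open>cemetery_measure\<close>, and its unspecified value at
    \<open>None\<close> is masked by the test \<open>c \<in> {None}\<close>.\<close>
  have *: "(\<lambda>(a, c). observation_density wt (\<lambda>v. q (v - g a)) c) =
    (\<lambda>(a, c). if wt = 1 then (if c \<in> {None} then 0 else q (the c - g a)) else indicator {None} c)"
    by (auto simp: observation_density_def fun_eq_iff indicator_def split: option.split)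
  show ?thesis
  proof (cases "wt = 1")
    case True
    note [measurable] = assms(2)[OF True]
    show ?thesis
      unfolding * using True by simp
  next
    case False
    then show ?thesis
      unfolding * by simp
  qed
qed

text \<open>For a fixed parameter the noise-free value is a constant \<open>g\<close>, so a
  measurement is the noise pushed forward by a translation and by \<open>Some\<close>. Without a
  measurement the law is the point mass at \<open>None\<close>.\<close>

lemma distr_observation:
  fixes \<epsilon> :: "'o \<Rightarrow> 'y::euclidean_space"
  assumes "prob_space P" and e: "distributed P lborel \<epsilon> (\<lambda>v. ennreal (q v))" "\<And>v. 0 \<le> q v"
  shows "distr P cemetery_measure (\<lambda>\<omega>. if wt = 1 then Some (g + \<epsilon> \<omega>) else None) =
    density cemetery_measure (\<lambda>c. ennreal (observation_density wt (\<lambda>v. q (v - g)) c))"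
proof (cases "wt = 1")
  case True
  interpret prob_space P by fact
  have [measurable]: "\<epsilon> \<in> borel_measurable P"
    using distributed_measurable[OF e(1)] by simp
  have q [measurable]: "q \<in> borel_measurable borel"
    using distributed_real_measurable[OF e(2,1)] by simp
  let ?f = "\<lambda>c. ennreal (observation_density wt (\<lambda>v. q (v - g)) c)"
  \<comment> \<open>The shift \<open>g\<close> does not vary here, so the parameter component is a
    dummy, frozen at \<open>0::real\<close>.\<close>
  have f [measurable]: "?f \<in> borel_measurable cemetery_measure"
    using measurable_compose[OF measurable_Pair1'[of "0::real" borel cemetery_measure]
        observation_density_measurable[OF q, of wt "\<lambda>_. g"]] by simp
  have "density cemetery_measure ?f = density (density cemetery_measure (indicator (range Some))) ?f"
    by (subst density_density_eq)
      (use f in \<open>auto intro!: density_cong simp: observation_density_def indicator_def True split: option.split\<close>)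
  also have "\<dots> = distr (density lborel (\<lambda>v. ?f (Some v))) cemetery_measure Some"
    unfolding density_cemetery_measure_range_Some by (subst density_distr) auto
  \<comment> \<open>Translation invariance: the image of Lebesgue measure under \<open>(+) g\<close>
    is again Lebesgue measure.\<close>
  also have "density lborel (\<lambda>v. ?f (Some v)) = density (distr lborel borel ((+) g)) (\<lambda>v. q (v - g))"
    by (simp add: observation_density_def True lborel_distr_plus)
  also have "\<dots> = distr (density lborel (\<lambda>v. q v)) borel ((+) g)"
    by (subst density_distr) auto
  also have "density lborel (\<lambda>v. q v) = distr P lborel \<epsilon>"
    by (rule distributed_distr_eq_density[OF e(1), symmetric])
  also have "distr (distr (distr P lborel \<epsilon>) borel ((+) g)) cemetery_measure Some =
      distr P cemetery_measure (\<lambda>\<omega>. Some (g + \<epsilon> \<omega>))"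
    by (simp add: distr_distr comp_def)
  finally show ?thesis
    by (simp add: True)
next
  case False
  interpret prob_space P by fact
  have "(\<lambda>c. ennreal (observation_density wt (\<lambda>v. q (v - g)) c)) = indicator {None}"
    using False by (auto simp: observation_density_def fun_eq_iff indicator_def split: option.split)
  then show ?thesis
    using False by (simp add: density_cemetery_measure_None distr_const)
qed

text \<open>Independence factorises the probability of a box, Fubini factorises the integral of the
  product density over it, and boxes determine a measure on a finite product. It serves both for the
  sensors within a block and for the blocks within a history.\<close>

lemma (in prob_space) distr_indep_vars_density:
  fixes f :: "'i \<Rightarrow> 'b \<Rightarrow> real"
  assumes I: "finite I" and N: "product_sigma_finite N" and ind: "indep_vars N V I"
    and f: "\<And>i. i \<in> I \<Longrightarrow> f i \<in> borel_measurable (N i)" "\<And>i v. i \<in> I \<Longrightarrow> 0 \<le> f i v"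
    and law: "\<And>i. i \<in> I \<Longrightarrow> distr M (N i) (V i) = density (N i) (\<lambda>v. ennreal (f i v))"
  shows "distr M (PiM I N) (\<lambda>\<omega>. \<lambda>i\<in>I. V i \<omega>) = density (PiM I N) (\<lambda>v. ennreal (\<Prod>i\<in>I. f i (v i)))"
proof -
  interpret product_sigma_finite N by fact
  have V [measurable]: "V i \<in> measurable M (N i)" if "i \<in> I" for i
    using ind that by (auto simp: indep_vars_def2)
  have V' [measurable]: "(\<lambda>\<omega>. \<lambda>i\<in>I. V i \<omega>) \<in> measurable M (PiM I N)"
    by (intro measurable_restrict) simp
  have F [measurable]: "(\<lambda>v. ennreal (\<Prod>i\<in>I. f i (v i))) \<in> borel_measurable (PiM I N)"
    using f(1) by (auto intro!: measurable_compose[OF _ measurable_ennreal] borel_measurable_prod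
      intro: measurable_compose[OF measurable_component_singleton])
  interpret D: prob_space "distr M (PiM I N) (\<lambda>\<omega>. \<lambda>i\<in>I. V i \<omega>)"
    by (rule prob_space_distr) simp
  show ?thesis
  \<comment> \<open>The exhausting sequence is constantly the whole space, which has finite mass
    since the left side is a probability measure.\<close>
  proof (rule measure_eqI_PiM_finite[where A = "\<lambda>_. Pi\<^sub>E I (\<lambda>i. space (N i))"])
    fix A assume A: "\<And>i. i \<in> I \<Longrightarrow> A i \<in> sets (N i)"
    have [measurable]: "Pi\<^sub>E I A \<in> sets (PiM I N)"
      using I A by (intro sets_PiM_I_finite) auto
    have "emeasure (distr M (PiM I N) (\<lambda>\<omega>. \<lambda>i\<in>I. V i \<omega>)) (Pi\<^sub>E I A) =
        emeasure M ((\<lambda>\<omega>. \<lambda>i\<in>I. V i \<omega>) -` Pi\<^sub>E I A \<inter> space M)"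
      by (rule emeasure_distr) auto
    also have "\<dots> = (\<Prod>i\<in>I. emeasure M (V i -` A i \<inter> space M))"
    \<comment> \<open>\<open>indep_varsD_finite\<close> asks for a nonempty index set, but the empty
      one does occur: the history before the first block has no components.\<close>
    proof (cases "I = {}")
      case False
      have "(\<lambda>\<omega>. \<lambda>i\<in>I. V i \<omega>) -` Pi\<^sub>E I A \<inter> space M = (\<Inter>i\<in>I. V i -` A i \<inter> space M)"
        using False by (auto simp: PiE_iff)
      then show ?thesis
        using indep_varsD_finite[OF ind False I A] by (simp add: emeasure_eq_measure prod_ennreal)
    next
      case True
      then have "(\<lambda>\<omega>. \<lambda>i\<in>I. V i \<omega>) -` Pi\<^sub>E I A \<inter> space M = space M"
        by auto
      then show ?thesis
        using True by (simp only: emeasure_space_1) simp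
    qed
    also have "\<dots> = (\<Prod>i\<in>I. \<integral>\<^sup>+v. ennreal (f i v) * indicator (A i) v \<partial>N i)"
    proof (rule prod.cong[OF refl])
      fix i assume i: "i \<in> I"
      have "emeasure M (V i -` A i \<inter> space M) = emeasure (distr M (N i) (V i)) (A i)"
        using i A by (subst emeasure_distr) auto
      then show "emeasure M (V i -` A i \<inter> space M) = (\<integral>\<^sup>+v. ennreal (f i v) * indicator (A i) v \<partial>N i)"
        using i A f by (simp add: law emeasure_density)
    qed
    also have "\<dots> = (\<integral>\<^sup>+v. (\<Prod>i\<in>I. ennreal (f i (v i)) * indicator (A i) (v i)) \<partial>PiM I N)"
      using A f by (intro product_nn_integral_prod[OF I, symmetric]) auto
    also have "\<dots> = (\<integral>\<^sup>+v. ennreal (\<Prod>i\<in>I. f i (v i)) * indicator (Pi\<^sub>E I A) v \<partial>PiM I N)"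
    proof (rule nn_integral_cong)
      fix v assume v: "v \<in> space (PiM I N)"
      have "(\<Prod>i\<in>I. indicator (A i) (v i) :: ennreal) = indicator (Pi\<^sub>E I A) v"
        using v I by (auto simp: indicator_def PiE_iff space_PiM prod_zero_iff)
      then show "(\<Prod>i\<in>I. ennreal (f i (v i)) * indicator (A i) (v i)) =
          ennreal (\<Prod>i\<in>I. f i (v i)) * indicator (Pi\<^sub>E I A) v"
        using f(2) by (simp add: prod.distrib prod_ennreal)
    qed
    also have "\<dots> = emeasure (density (PiM I N) (\<lambda>v. ennreal (\<Prod>i\<in>I. f i (v i)))) (Pi\<^sub>E I A)"
      by (rule emeasure_density[symmetric]) auto
    finally show "emeasure (distr M (PiM I N) (\<lambda>\<omega>. \<lambda>i\<in>I. V i \<omega>)) (Pi\<^sub>E I A) =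
        emeasure (density (PiM I N) (\<lambda>v. ennreal (\<Prod>i\<in>I. f i (v i)))) (Pi\<^sub>E I A)" .
  qed (use I in \<open>auto simp: space_PiM intro!: prod_algebraI_finite\<close>)
qed

text \<open>Rectangles determine the product law, and on them the claim is the independence of two
  preimages. Independence is phrased through generated sigma-algebras so that \<open>X\<close> and
  \<open>Y\<close> may take values in different types.\<close>

lemma (in prob_space) distr_pair_eq_of_indep_set:
  assumes X: "X \<in> measurable M S" and Y: "Y \<in> measurable M T"
    and ind: "indep_set (sets (vimage_algebra (space M) X S)) (sets (vimage_algebra (space M) Y T))"
  shows "distr M S X \<Otimes>\<^sub>M distr M T Y = distr M (S \<Otimes>\<^sub>M T) (\<lambda>\<omega>. (X \<omega>, Y \<omega>))"
proof (rule pair_measure_eqI)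
  note [measurable] = X Y
  interpret X: prob_space "distr M S X" by (rule prob_space_distr) fact
  interpret Y: prob_space "distr M T Y" by (rule prob_space_distr) fact
  show "sigma_finite_measure (distr M S X)" "sigma_finite_measure (distr M T Y)"
    by unfold_locales
  fix A B assume "A \<in> sets (distr M S X)" "B \<in> sets (distr M T Y)"
  then have [measurable]: "A \<in> sets S" "B \<in> sets T"
    by simp_all
  have "prob ((X -` A \<inter> space M) \<inter> (Y -` B \<inter> space M)) = prob (X -` A \<inter> space M) * prob (Y -` B \<inter> space M)"
    by (rule indep_setD[OF ind]) (auto intro: in_vimage_algebra)
  moreover have "(\<lambda>\<omega>. (X \<omega>, Y \<omega>)) -` (A \<times> B) \<inter> space M = (X -` A \<inter> space M) \<inter> (Y -` B \<inter> space M)"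
    by auto
  ultimately show "emeasure (distr M S X) A * emeasure (distr M T Y) B =
      emeasure (distr M (S \<Otimes>\<^sub>M T) (\<lambda>\<omega>. (X \<omega>, Y \<omega>))) (A \<times> B)"
    by (simp add: emeasure_distr emeasure_eq_measure ennreal_mult)
qed simp

lemma (in bayes_prior) observes_of_conditional_law:
  assumes N: "sigma_finite_measure N" and L: "\<And>a b. 0 \<le> L a b"
    and Lm [measurable]: "(\<lambda>(a, b). L a b) \<in> borel_measurable (borel \<Otimes>\<^sub>M N)"
    and E [measurable]: "E \<in> measurable P Q"
    and ind: "indep_set (sets (vimage_algebra (space P) X borel)) (sets (vimage_algebra (space P) E Q))"
    and F [measurable]: "(\<lambda>(a, e). F a e) \<in> measurable (borel \<Otimes>\<^sub>M Q) N"
    and law: "\<And>a. distr P N (\<lambda>\<omega>. F a (E \<omega>)) = density N (\<lambda>b. ennreal (L a b))"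
  shows "observes P p0 X N L (\<lambda>\<omega>. F (X \<omega>) (E \<omega>))"
proof -
  interpret N: sigma_finite_measure N by fact
  have Xm [measurable]: "X \<in> borel_measurable P"
    using distributed_measurable[OF X] by simp
  note XE = distr_pair_eq_of_indep_set[OF Xm E ind]
  interpret E: prob_space "distr P Q E" by (rule prob_space_distr) simp
  have sb [measurable_cong]: "sets (lborel \<Otimes>\<^sub>M N) = sets (borel \<Otimes>\<^sub>M N)"
    by (rule sets_pair_measure_cong) simp_all
  have dX: "distr P borel X = density lborel p0"
    using distributed_distr_eq_density[OF X] by (simp cong: distr_cong)
  let ?f = "\<lambda>(a, b). ennreal (p0 a * L a b)"
  have f [measurable]: "?f \<in> borel_measurable (lborel \<Otimes>\<^sub>M N)"
    by measurable
  have "distr P (lborel \<Otimes>\<^sub>M N) (\<lambda>\<omega>. (X \<omega>, F (X \<omega>) (E \<omega>))) = density (lborel \<Otimes>\<^sub>M N) ?f"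
  proof (rule measure_eqI)
    fix A assume "A \<in> sets (distr P (lborel \<Otimes>\<^sub>M N) (\<lambda>\<omega>. (X \<omega>, F (X \<omega>) (E \<omega>))))"
    then have A [measurable]: "A \<in> sets (borel \<Otimes>\<^sub>M N)"
      by (simp add: sb)
    have "emeasure (distr P (lborel \<Otimes>\<^sub>M N) (\<lambda>\<omega>. (X \<omega>, F (X \<omega>) (E \<omega>)))) A =
        (\<integral>\<^sup>+\<omega>. indicator A (X \<omega>, F (X \<omega>) (E \<omega>)) \<partial>P)"
      by (subst nn_integral_indicator[symmetric], simp add: sb, subst nn_integral_distr) auto
    also have "\<dots> = (\<integral>\<^sup>+(a, e). indicator A (a, F a e) \<partial>distr P (borel \<Otimes>\<^sub>M Q) (\<lambda>\<omega>. (X \<omega>, E \<omega>)))"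
      by (subst nn_integral_distr) auto
    also have "\<dots> = (\<integral>\<^sup>+(a, e). indicator A (a, F a e) \<partial>(distr P borel X \<Otimes>\<^sub>M distr P Q E))"
      by (simp add: XE)
    also have "\<dots> = (\<integral>\<^sup>+a. \<integral>\<^sup>+e. indicator A (a, F a e) \<partial>distr P Q E \<partial>distr P borel X)"
      by (subst E.nn_integral_fst[symmetric]) auto
    \<comment> \<open>For fixed \<open>a\<close> the inner integral depends only on the law of
      \<open>F a (E \<omega>)\<close>, which has density \<open>L a\<close>.\<close>
    also have "\<dots> = (\<integral>\<^sup>+a. \<integral>\<^sup>+b. ennreal (L a b) * indicator A (a, b) \<partial>N \<partial>distr P borel X)"
    proof (rule nn_integral_cong)
      fix a :: 'p
      have [measurable]: "F a \<in> measurable Q N"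
        using measurable_compose[OF measurable_Pair1'[of a borel Q] F] by simp
      have [measurable]: "L a \<in> borel_measurable N"
        using measurable_compose[OF measurable_Pair1'[of a borel N] Lm] by simp
      have [measurable]: "(\<lambda>b. indicator A (a, b) :: ennreal) \<in> borel_measurable N"
        using measurable_compose[OF measurable_Pair1'[of a borel N], of "indicator A"] by simp
      have "(\<integral>\<^sup>+e. indicator A (a, F a e) \<partial>distr P Q E) = (\<integral>\<^sup>+b. indicator A (a, b) \<partial>distr P N (\<lambda>\<omega>. F a (E \<omega>)))"
        by (simp add: nn_integral_distr)
      also have "\<dots> = (\<integral>\<^sup>+b. ennreal (L a b) * indicator A (a, b) \<partial>N)"
        unfolding law by (rule nn_integral_density) auto
      finally show "(\<integral>\<^sup>+e. indicator A (a, F a e) \<partial>distr P Q E) = (\<integral>\<^sup>+b. ennreal (L a b) * indicator A (a, b) \<partial>N)" .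
    qed
    also have "\<dots> = (\<integral>\<^sup>+a. ennreal (p0 a) * (\<integral>\<^sup>+b. ennreal (L a b) * indicator A (a, b) \<partial>N) \<partial>lborel)"
      unfolding dX by (subst nn_integral_density) auto
    also have "\<dots> = (\<integral>\<^sup>+a. \<integral>\<^sup>+b. ?f (a, b) * indicator A (a, b) \<partial>N \<partial>lborel)"
    proof (rule nn_integral_cong)
      fix a :: 'p
      have [measurable]: "L a \<in> borel_measurable N"
        using measurable_compose[OF measurable_Pair1'[of a borel N] Lm] by simp
      have [measurable]: "(\<lambda>b. indicator A (a, b) :: ennreal) \<in> borel_measurable N"
        using measurable_compose[OF measurable_Pair1'[of a borel N], of "indicator A"] by simp
      show "ennreal (p0 a) * (\<integral>\<^sup>+b. ennreal (L a b) * indicator A (a, b) \<partial>N) =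
          (\<integral>\<^sup>+b. ?f (a, b) * indicator A (a, b) \<partial>N)"
        using p0_nonneg L by (subst nn_integral_cmult[symmetric]) (auto simp: ennreal_mult mult.assoc)
    qed
    also have "\<dots> = (\<integral>\<^sup>+z. ?f z * indicator A z \<partial>(lborel \<Otimes>\<^sub>M N))"
      by (subst N.nn_integral_fst) auto
    also have "\<dots> = emeasure (density (lborel \<Otimes>\<^sub>M N) ?f) A"
      by (rule emeasure_density[symmetric]) auto
    finally show "emeasure (distr P (lborel \<Otimes>\<^sub>M N) (\<lambda>\<omega>. (X \<omega>, F (X \<omega>) (E \<omega>)))) A =
        emeasure (density (lborel \<Otimes>\<^sub>M N) ?f) A" .
  qed simp
  then show ?thesis
    using N L by (simp add: observes_def distributed_def)
qed

section \<open>Laws of blocks and histories\<close>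

locale sensor_experiment = bayes_prior P p0 X
  for P :: "'o measure" and p0 :: "'p::euclidean_space \<Rightarrow> real" and X :: "'o \<Rightarrow> 'p" +
  fixes M n :: nat and h :: "nat \<Rightarrow> 'x \<Rightarrow> 'y::euclidean_space" and x :: "(real \<Rightarrow> 'u) \<Rightarrow> 'p \<Rightarrow> real \<Rightarrow> 'x"
    and t :: "nat \<Rightarrow> real" and u :: "real \<Rightarrow> 'u" and w :: "nat \<Rightarrow> nat \<Rightarrow> nat"
    and p_noise :: "nat \<Rightarrow> nat \<Rightarrow> 'y \<Rightarrow> real" and \<epsilon> :: "nat \<Rightarrow> nat \<Rightarrow> 'o \<Rightarrow> 'y"
  assumes meas: "\<lbrakk>i \<in> {1..M}; d \<in> {1..n}; w i d = 1\<rbrakk> \<Longrightarrow> (\<lambda>\<tau>. h d (x u \<tau> (t i))) \<in> borel_measurable borel"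
    and noise_nonneg: "\<lbrakk>i \<in> {1..M}; d \<in> {1..n}\<rbrakk> \<Longrightarrow> 0 \<le> p_noise i d v"
    and noise: "\<lbrakk>i \<in> {1..M}; d \<in> {1..n}\<rbrakk> \<Longrightarrow> distributed P lborel (\<epsilon> i d) (\<lambda>v. ennreal (p_noise i d v))"
    and indep_noise: "indep_vars (\<lambda>_. borel) (\<lambda>(i, d). \<epsilon> i d) ({1..M} \<times> {1..n})"
    and indep_prior: "indep_set
      (sets (vimage_algebra (space P) X borel))
      (sets (vimage_algebra (space P) (\<lambda>\<omega>. \<lambda>(i, d)\<in>{1..M} \<times> {1..n}. \<epsilon> i d \<omega>)
        (\<Pi>\<^sub>M k\<in>{1..M} \<times> {1..n}. borel)))"
begin

abbreviation likelihood where "likelihood \<equiv> block_likelihood n x h t p_noise w u"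

abbreviation sensor_likelihood where "sensor_likelihood i a d \<equiv> observation_density (w i d) (\<lambda>v. p_noise i d (v - h d (x u a (t i))))"

definition history_likelihood where "history_likelihood k a c = (\<Prod>i\<in>{1..k}. likelihood i a (c i))"

definition noise_vector :: "'o \<Rightarrow> nat \<times> nat \<Rightarrow> 'y" where
  "noise_vector \<omega> = (\<lambda>(i, d)\<in>{1..M} \<times> {1..n}. \<epsilon> i d \<omega>)"

lemma noise_vector_apply: "i \<in> {1..M} \<Longrightarrow> d \<in> {1..n} \<Longrightarrow> noise_vector \<omega> (i, d) = \<epsilon> i d \<omega>"
  by (simp add: noise_vector_def)

text \<open>The observation as a deterministic function of a frozen parameter \<open>a\<close> and a
  realisation \<open>e\<close> of all noises. Conditioning on the parameter becomes fixing
  \<open>a\<close>, and substituting \<open>X\<close> and \<open>noise_vector\<close> recovers the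
  actual data.\<close>

definition obs where
  "obs a e i d = (if w i d = 1 then Some (h d (x u a (t i)) + e (i, d)) else None)"

definition obs_block where "obs_block a e i = (\<lambda>d\<in>{1..n}. obs a e i d)"

definition obs_history where "obs_history k a e = (\<lambda>i\<in>{1..k}. obs_block a e i)"

abbreviation noise_space :: "(nat \<times> nat \<Rightarrow> 'y) measure" where
  "noise_space \<equiv> (\<Pi>\<^sub>M k\<in>{1..M} \<times> {1..n}. borel)"

lemma noise_vector_measurable [measurable]: "noise_vector \<in> measurable P noise_space"
  unfolding noise_vector_def using indep_noise
  by (intro measurable_restrict) (auto simp: indep_vars_def2)

lemma indep_prior_noise_vector:
  "indep_set (sets (vimage_algebra (space P) X borel)) (sets (vimage_algebra (space P) noise_vector noise_space))"
  using indep_prior by (simp add: noise_vector_def[abs_def])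

section \<open>Measurability of observations and likelihoods\<close>

lemma obs_measurable:
  assumes "i \<in> {1..M}" "d \<in> {1..n}"
  shows "(\<lambda>(a, e). obs a e i d) \<in> measurable (borel \<Otimes>\<^sub>M noise_space) cemetery_measure"
proof (cases "w i d = 1")
  case True
  note [measurable] = meas[OF assms True]
  have [measurable]: "(\<lambda>e. e (i, d)) \<in> measurable noise_space borel"
    by (rule measurable_component_singleton) (use assms in auto)
  show ?thesis
    unfolding obs_def if_P[OF True] by measurable
qed (simp add: obs_def)

lemma obs_block_measurable:
  assumes "i \<in> {1..M}"
  shows "(\<lambda>(a, e). obs_block a e i) \<in> measurable (borel \<Otimes>\<^sub>M noise_space) (block_space n)"
  using obs_measurable[OF assms] unfolding obs_block_def block_space_def case_prod_beta'
  by (intro measurable_restrict)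

lemma obs_history_measurable:
  assumes "k \<le> M"
  shows "(\<lambda>(a, e). obs_history k a e) \<in> measurable (borel \<Otimes>\<^sub>M noise_space) (history_space n k)"
  using obs_block_measurable assms unfolding obs_history_def history_space_def case_prod_beta'
  by (intro measurable_restrict) auto

lemma sensor_likelihood_nonneg: "i \<in> {1..M} \<Longrightarrow> d \<in> {1..n} \<Longrightarrow> 0 \<le> sensor_likelihood i a d v"
  using noise_nonneg by (auto simp: observation_density_def split: option.split)

lemma sensor_likelihood_measurable:
  assumes "i \<in> {1..M}" "d \<in> {1..n}"
  shows "(\<lambda>(a, c). sensor_likelihood i a d c) \<in> borel_measurable (borel \<Otimes>\<^sub>M cemetery_measure)"
  using distributed_real_measurable[OF noise_nonneg noise] meas assms
  by (intro observation_density_measurable) auto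

lemma likelihood_nonneg: "i \<in> {1..M} \<Longrightarrow> 0 \<le> likelihood i a b"
  unfolding block_likelihood_def by (intro prod_nonneg ballI sensor_likelihood_nonneg)

lemma likelihood_measurable:
  assumes "i \<in> {1..M}"
  shows "(\<lambda>(a, b). likelihood i a b) \<in> borel_measurable (borel \<Otimes>\<^sub>M block_space n)"
  unfolding block_likelihood_def case_prod_beta'
proof (rule borel_measurable_prod)
  fix d assume d: "d \<in> {1..n}"
  have "(\<lambda>z. (fst z, snd z d)) \<in> measurable (borel \<Otimes>\<^sub>M block_space n) (borel \<Otimes>\<^sub>M cemetery_measure)"
    using d unfolding block_space_def by measurable
  from measurable_compose[OF this sensor_likelihood_measurable[OF assms d]]
  show "(\<lambda>z. sensor_likelihood i (fst z) d (snd z d)) \<in> borel_measurable (borel \<Otimes>\<^sub>M block_space n)"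
    by simp
qed

lemma history_likelihood_nonneg: "k \<le> M \<Longrightarrow> 0 \<le> history_likelihood k a c"
  unfolding history_likelihood_def by (intro prod_nonneg ballI likelihood_nonneg) auto

lemma history_likelihood_measurable:
  assumes "k \<le> M"
  shows "(\<lambda>(a, c). history_likelihood k a c) \<in> borel_measurable (borel \<Otimes>\<^sub>M history_space n k)"
  unfolding history_likelihood_def case_prod_beta'
proof (rule borel_measurable_prod)
  fix i assume i: "i \<in> {1..k}"
  have "(\<lambda>z. (fst z, snd z i)) \<in> measurable (borel \<Otimes>\<^sub>M history_space n k) (borel \<Otimes>\<^sub>M block_space n)"
    using i unfolding history_space_def by measurable
  from measurable_compose[OF this likelihood_measurable[of i]] i assms
  show "(\<lambda>z. likelihood i (fst z) (snd z i)) \<in> borel_measurable (borel \<Otimes>\<^sub>M history_space n k)"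
    by simp
qed

section \<open>Conditional independence at a fixed parameter\<close>

lemma measurable_section:
  assumes "(\<lambda>(a, b). f a b) \<in> measurable (borel \<Otimes>\<^sub>M N) N'"
  shows "f a \<in> measurable N N'"
  using measurable_compose[OF measurable_Pair1'[of a borel N] assms] by simp

lemma distr_obs:
  assumes "i \<in> {1..M}" "d \<in> {1..n}"
  shows "distr P cemetery_measure (\<lambda>\<omega>. obs a (noise_vector \<omega>) i d) =
    density cemetery_measure (\<lambda>c. ennreal (sensor_likelihood i a d c))"
  using distr_observation[OF prob_space_axioms noise[OF assms] noise_nonneg[OF assms],
      of "w i d" "h d (x u a (t i))"]
  unfolding obs_def noise_vector_apply[OF assms] .

text \<open>At fixed \<open>a\<close> each observation is a measurable function of its own noise
  alone, so it inherits the independence of the noises.\<close>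

lemma indep_vars_obs:
  "indep_vars (\<lambda>_. cemetery_measure) (\<lambda>(i, d) \<omega>. obs a (noise_vector \<omega>) i d) ({1..M} \<times> {1..n})"
proof -
  have "indep_vars (\<lambda>_. cemetery_measure)
      (\<lambda>k \<omega>. (\<lambda>(i, d) v. if w i d = 1 then Some (h d (x u a (t i)) + v) else None) k ((\<lambda>(i, d). \<epsilon> i d) k \<omega>))
      ({1..M} \<times> {1..n})"
    by (rule indep_vars_compose2[OF indep_noise]) (auto split: prod.split)
  then show ?thesis
    by (rule indep_vars_cong[THEN iffD1, rotated 3]) (auto simp: obs_def noise_vector_apply)
qed

text \<open>The sets \<open>{i} \<times> {1..n}\<close> are disjoint rows of the index grid, so
  grouping by rows preserves independence; renaming \<open>(i, d)\<close> to \<open>d\<close> then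
  turns each row into a block.\<close>

lemma indep_vars_obs_block:
  "indep_vars (\<lambda>_. block_space n) (\<lambda>i \<omega>. obs_block a (noise_vector \<omega>) i) {1..M}"
proof -
  have "indep_vars (\<lambda>i. \<Pi>\<^sub>M k\<in>{i} \<times> {1..n}. cemetery_measure)
      (\<lambda>i \<omega>. \<lambda>k\<in>{i} \<times> {1..n}. (\<lambda>(i, d) \<omega>. obs a (noise_vector \<omega>) i d) k \<omega>) {1..M}"
    by (rule indep_vars_restrict[OF indep_vars_obs]) (auto simp: disjoint_family_on_def)
  then have "indep_vars (\<lambda>_. block_space n)
      (\<lambda>i \<omega>. (\<lambda>v. \<lambda>d\<in>{1..n}. v (i, d)) (\<lambda>k\<in>{i} \<times> {1..n}. (\<lambda>(i, d) \<omega>. obs a (noise_vector \<omega>) i d) k \<omega>)) {1..M}"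
  proof (rule indep_vars_compose2)
    show "(\<lambda>v. \<lambda>d\<in>{1..n}. v (i, d)) \<in> measurable (\<Pi>\<^sub>M k\<in>{i} \<times> {1..n}. cemetery_measure) (block_space n)" for i
      unfolding block_space_def by (intro measurable_restrict measurable_component_singleton) auto
  qed
  then show ?thesis
    by (rule indep_vars_cong[THEN iffD1, rotated 3]) (auto simp: obs_block_def fun_eq_iff)
qed

text \<open>Row \<open>i\<close> of the grid is reindexed by \<open>d\<close>: it is grouped into
  the singletons \<open>{(i, d)}\<close>, and each group is evaluated at its one index.\<close>

lemma indep_vars_obs_sensor:
  assumes "i \<in> {1..M}"
  shows "indep_vars (\<lambda>_. cemetery_measure) (\<lambda>d \<omega>. obs a (noise_vector \<omega>) i d) {1..n}"
proof -
  have "indep_vars (\<lambda>d. \<Pi>\<^sub>M k\<in>{(i, d)}. cemetery_measure)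
      (\<lambda>d \<omega>. \<lambda>k\<in>{(i, d)}. (\<lambda>(i, d) \<omega>. obs a (noise_vector \<omega>) i d) k \<omega>) {1..n}"
    by (rule indep_vars_restrict[OF indep_vars_obs]) (use assms in \<open>auto simp: disjoint_family_on_def\<close>)
  then have "indep_vars (\<lambda>_. cemetery_measure)
      (\<lambda>d \<omega>. (\<lambda>v. v (i, d)) (\<lambda>k\<in>{(i, d)}. (\<lambda>(i, d) \<omega>. obs a (noise_vector \<omega>) i d) k \<omega>)) {1..n}"
    by (rule indep_vars_compose2) (auto intro!: measurable_component_singleton)
  then show ?thesis
    by simp
qed

lemma distr_obs_block:
  assumes i: "i \<in> {1..M}"
  shows "distr P (block_space n) (\<lambda>\<omega>. obs_block a (noise_vector \<omega>) i) =
    density (block_space n) (\<lambda>b. ennreal (likelihood i a b))"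
  unfolding obs_block_def block_space_def block_likelihood_def
  by (rule distr_indep_vars_density)
    (use i in \<open>auto intro!: product_sigma_finite_const sigma_finite_cemetery_measure
        indep_vars_obs_sensor[OF i, simplified]
        sensor_likelihood_nonneg distr_obs measurable_section[OF sensor_likelihood_measurable]\<close>)

lemma distr_obs_history:
  assumes k: "k \<le> M"
  shows "distr P (history_space n k) (\<lambda>\<omega>. obs_history k a (noise_vector \<omega>)) =
    density (history_space n k) (\<lambda>c. ennreal (history_likelihood k a c))"
  unfolding obs_history_def history_space_def history_likelihood_def
  by (rule distr_indep_vars_density)
    (use k in \<open>auto intro!: product_sigma_finite_const sigma_finite_block_space
        indep_vars_subset[OF indep_vars_obs_block]
        likelihood_nonneg distr_obs_block measurable_section[OF likelihood_measurable]\<close>)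

text \<open>The past uses rows \<open>1\<close> to \<open>i - 1\<close> of the noise and the current
  block uses row \<open>i\<close>. These are disjoint, so at fixed parameter the two are independent
  and their densities multiply.\<close>

lemma distr_obs_block_history:
  assumes i: "i \<in> {1..M}"
  shows "distr P (block_space n \<Otimes>\<^sub>M history_space n (i - 1))
      (\<lambda>\<omega>. (obs_block a (noise_vector \<omega>) i, obs_history (i - 1) a (noise_vector \<omega>))) =
    density (block_space n \<Otimes>\<^sub>M history_space n (i - 1)) (\<lambda>z. ennreal (case z of (b, c) \<Rightarrow> likelihood i a b * history_likelihood (i - 1) a c))"
proof -
  let ?Y = "\<lambda>\<omega>. obs_block a (noise_vector \<omega>) i" and ?Z = "\<lambda>\<omega>. obs_history (i - 1) a (noise_vector \<omega>)"
  let ?Y' = "\<lambda>\<omega>. \<lambda>j\<in>{i}. obs_block a (noise_vector \<omega>) j"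
  let ?S = "\<Pi>\<^sub>M j\<in>{i}. block_space n" and ?H = "history_space n (i - 1)"
  have k: "i - 1 \<le> M"
    using i by auto
  \<comment> \<open>The block is kept as a one-element family over \<open>{i}\<close>, so that it
    has the same type as the history over \<open>{1..i - 1}\<close>.\<close>
  have "indep_var ?S ?Y' ?H ?Z"
    unfolding history_space_def obs_history_def
    by (rule indep_var_restrict[OF indep_vars_obs_block]) (use i in auto)
  then have ind: "distr P ?S ?Y' \<Otimes>\<^sub>M distr P ?H ?Z = distr P (?S \<Otimes>\<^sub>M ?H) (\<lambda>\<omega>. (?Y' \<omega>, ?Z \<omega>))"
    and [measurable]: "?Y' \<in> measurable P ?S" and Z [measurable]: "?Z \<in> measurable P ?H"
    unfolding indep_var_distribution_eq by blast+
  have ev [measurable]: "(\<lambda>v. v i) \<in> measurable ?S (block_space n)"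
    by (rule measurable_component_singleton) simp
  have Y [measurable]: "?Y \<in> measurable P (block_space n)"
    using measurable_compose[of ?Y' P ?S, OF _ ev] by simp
  interpret Z: prob_space "distr P ?H ?Z" by (rule prob_space_distr) measurable
  \<comment> \<open>Evaluation at \<open>i\<close> unwraps the one-element family; a map applied to
    one factor of a product law yields a product law again.\<close>
  have "distr P (block_space n) ?Y \<Otimes>\<^sub>M distr P ?H ?Z =
      distr (distr P ?S ?Y') (block_space n) (\<lambda>v. v i) \<Otimes>\<^sub>M distr (distr P ?H ?Z) ?H (\<lambda>c. c)"
    by (simp add: distr_distr comp_def del: One_nat_def)
  also have "\<dots> = distr (distr P ?S ?Y' \<Otimes>\<^sub>M distr P ?H ?Z) (block_space n \<Otimes>\<^sub>M ?H) (\<lambda>(v, c). (v i, c))"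
    by (rule pair_measure_distr) (simp_all add: distr_distr comp_def Z.sigma_finite_measure_axioms del: One_nat_def)
  also have "\<dots> = distr P (block_space n \<Otimes>\<^sub>M ?H) (\<lambda>\<omega>. (?Y \<omega>, ?Z \<omega>))"
    unfolding ind by (simp add: distr_distr comp_def del: One_nat_def)
  finally have ind': "distr P (block_space n) ?Y \<Otimes>\<^sub>M distr P ?H ?Z =
      distr P (block_space n \<Otimes>\<^sub>M ?H) (\<lambda>\<omega>. (?Y \<omega>, ?Z \<omega>))" .
  have "distributed P (block_space n \<Otimes>\<^sub>M ?H) (\<lambda>\<omega>. (?Y \<omega>, ?Z \<omega>))
      (\<lambda>(b, c). ennreal (likelihood i a b) * ennreal (history_likelihood (i - 1) a c))"
  proof (rule distributed_joint_indep'[OF sigma_finite_block_space sigma_finite_history_space _ _ ind'])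
    show "distributed P (block_space n) ?Y (\<lambda>b. ennreal (likelihood i a b))"
      using Y measurable_section[OF likelihood_measurable[OF i]]
      by (simp add: distributed_def distr_obs_block[OF i])
    show "distributed P ?H ?Z (\<lambda>c. ennreal (history_likelihood (i - 1) a c))"
      using Z measurable_section[OF history_likelihood_measurable[OF k]]
      by (simp add: distributed_def distr_obs_history[OF k] del: One_nat_def)
  qed
  then show ?thesis
    using likelihood_nonneg[OF i] history_likelihood_nonneg[OF k]
    by (simp add: distributed_def ennreal_mult case_prod_beta')
qed

section \<open>Joint densities of the parameter with blocks and histories\<close>

lemma observes_block:
  assumes i: "i \<in> {1..M}"
  shows "observes P p0 X (block_space n) (likelihood i) (\<lambda>\<omega>. obs_block (X \<omega>) (noise_vector \<omega>) i)"
  by (rule observes_of_conditional_law[where F = "\<lambda>a e. obs_block a e i", OF sigma_finite_block_space likelihood_nonneg[OF i] likelihood_measurable[OF i]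
    noise_vector_measurable indep_prior_noise_vector obs_block_measurable[OF i] distr_obs_block[OF i]])

lemma observes_history:
  assumes k: "k \<le> M"
  shows "observes P p0 X (history_space n k) (history_likelihood k) (\<lambda>\<omega>. obs_history k (X \<omega>) (noise_vector \<omega>))"
  by (rule observes_of_conditional_law[where F = "obs_history k", OF sigma_finite_history_space history_likelihood_nonneg[OF k] history_likelihood_measurable[OF k]
    noise_vector_measurable indep_prior_noise_vector obs_history_measurable[OF k] distr_obs_history[OF k]])

lemma observes_block_history:
  assumes i: "i \<in> {1..M}"
  shows "observes P p0 X (block_space n \<Otimes>\<^sub>M history_space n (i - 1)) (\<lambda>a (b, c). likelihood i a b * history_likelihood (i - 1) a c)
    (\<lambda>\<omega>. (obs_block (X \<omega>) (noise_vector \<omega>) i, obs_history (i - 1) (X \<omega>) (noise_vector \<omega>)))"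
proof (rule observes_of_conditional_law[where F = "\<lambda>a e. (obs_block a e i, obs_history (i - 1) a e)"])
  have k: "i - 1 \<le> M"
    using i by auto
  note [measurable] = likelihood_measurable[OF i] history_likelihood_measurable[OF k] obs_block_measurable[OF i] obs_history_measurable[OF k]
  show "sigma_finite_measure (block_space n \<Otimes>\<^sub>M history_space n (i - 1))"
    by (intro sigma_finite_pair_measure sigma_finite_block_space sigma_finite_history_space)
  show "0 \<le> (case z of (b, c) \<Rightarrow> likelihood i a b * history_likelihood (i - 1) a c)" for a z
    using likelihood_nonneg[OF i] history_likelihood_nonneg[OF k] by (auto split: prod.split)
  show "(\<lambda>(a, b, c). likelihood i a b * history_likelihood (i - 1) a c)
      \<in> borel_measurable (borel \<Otimes>\<^sub>M (block_space n \<Otimes>\<^sub>M history_space n (i - 1)))"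
    by measurable
  show "(\<lambda>(a, e). (obs_block a e i, obs_history (i - 1) a e))
      \<in> measurable (borel \<Otimes>\<^sub>M noise_space) (block_space n \<Otimes>\<^sub>M history_space n (i - 1))"
    by measurable
qed (fact noise_vector_measurable indep_prior_noise_vector distr_obs_block_history[OF i])+

text \<open>The last factor of the product over blocks is split off. The parameters \<open>a\<close>
  and \<open>b\<close> are separate because the data are generated at \<open>b\<close>, while the
  evidence integrates the likelihood over all \<open>a\<close>. The condition
  \<open>1 \<le> i\<close> keeps \<open>i - 1\<close> from being truncated.\<close>

lemma history_likelihood_step:
  assumes "1 \<le> i"
  shows "likelihood i a (obs_block b e i) * history_likelihood (i - 1) a (obs_history (i - 1) b e) = history_likelihood i a (obs_history i b e)"
proof -
  obtain k where i: "i = Suc k"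
    using assms by (cases i) auto
  show ?thesis
    by (simp add: i history_likelihood_def obs_history_def mult.commute)
qed

text \<open>Conditional mutual information is by definition a difference of two mutual informations.
  The first concerns the pair of block and past, whose log-likelihood ratio agrees pointwise with
  that of the longer history, so the two observation spaces need not be identified.\<close>

lemma cond_mutual_info_telescopes:
  assumes i: "i \<in> {1..M}"
  defines "Y \<equiv> \<lambda>k \<omega>. obs_history k (X \<omega>) (noise_vector \<omega>)"
  shows "cond_mutual_info P borel (block_space n) (history_space n (i - 1)) X
      (\<lambda>\<omega>. obs_block (X \<omega>) (noise_vector \<omega>) i) (Y (i - 1)) =
    mutual_info P borel (history_space n i) X (Y i) - mutual_info P borel (history_space n (i - 1)) X (Y (i - 1))"
proof -
  have k: "i \<le> M" "1 \<le> i"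
    using i by simp_all
  show ?thesis
    unfolding conditional_mutual_information_def Y_def
    using mutual_info_eq_llr[OF observes_block_history[OF i]]
      mutual_info_eq_llr[OF observes_history[OF k(1)]]
    by (simp add: log_likelihood_ratio_eq evidence_def history_likelihood_step[OF k(2), simplified])
qed

text \<open>The empty history has likelihood \<open>1\<close>, an empty product, and its evidence is
  the total prior mass, also \<open>1\<close>, so the log ratio vanishes identically. This anchors
  the telescoping sum.\<close>

lemma mutual_info_empty_history:
  "mutual_info P borel (history_space n 0) X (\<lambda>\<omega>. obs_history 0 (X \<omega>) (noise_vector \<omega>)) = 0"
proof -
  interpret D: prob_space "density lborel p0"
    unfolding distributed_distr_eq_density[OF X, symmetric]
    by (rule prob_space_distr) (rule distributed_measurable[OF X])
  have "(\<integral>a. p0 a \<partial>lborel) = 1"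
    using D.prob_space integral_density[of "\<lambda>_. 1::real" lborel p0] p0_nonneg by simp
  then show ?thesis
    by (simp add: mutual_info_eq_llr[OF observes_history] log_likelihood_ratio_eq evidence_def history_likelihood_def)
qed

lemma mutual_info_history_eq_sum:
  assumes "k \<le> M"
  shows "mutual_info P borel (history_space n k) X (\<lambda>\<omega>. obs_history k (X \<omega>) (noise_vector \<omega>)) =
    (\<Sum>i = 1..k. cond_mutual_info P borel (block_space n) (history_space n (i - 1)) X
      (\<lambda>\<omega>. obs_block (X \<omega>) (noise_vector \<omega>) i) (\<lambda>\<omega>. obs_history (i - 1) (X \<omega>) (noise_vector \<omega>)))"
  using assms
proof (induction k)
  case (Suc k)
  then show ?case
    using cond_mutual_info_telescopes[of "Suc k"] by simp
qed (simp add: mutual_info_empty_history)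

end

section \<open>The gap identity and the information bound for the controlled experiment\<close>

theorem lemma1:
  fixes P :: "'o measure"
    and f :: "real ^ 'nx \<Rightarrow> real ^ 'nu \<Rightarrow> real ^ 'np \<Rightarrow> real \<Rightarrow> real ^ 'nx"
    and x0 :: "real ^ 'nx" and T :: real and U :: "(real ^ 'nu) set"
    and x :: "(real \<Rightarrow> real ^ 'nu) \<Rightarrow> real ^ 'np \<Rightarrow> real \<Rightarrow> real ^ 'nx"
    and M n_exp :: nat and t :: "nat \<Rightarrow> real"
    and h :: "nat \<Rightarrow> real ^ 'nx \<Rightarrow> real ^ 'ny"
    and w :: "nat \<Rightarrow> nat \<Rightarrow> nat" and u :: "real \<Rightarrow> real ^ 'nu"
    and p0 :: "real ^ 'np \<Rightarrow> real" and p_noise :: "nat \<Rightarrow> nat \<Rightarrow> real ^ 'ny \<Rightarrow> real"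
    and \<theta> :: "'o \<Rightarrow> real ^ 'np" and \<epsilon> :: "nat \<Rightarrow> nat \<Rightarrow> 'o \<Rightarrow> real ^ 'ny"
    and y :: "nat \<Rightarrow> nat \<Rightarrow> 'o \<Rightarrow> (real ^ 'ny) option"
  assumes "0 \<le> T" and "compact U"
    and solution: "\<And>v \<tau>. v \<in> admissible_controls T U \<Longrightarrow> ode_solution f x0 T v \<tau> (x v \<tau>)"
    and unique: "\<And>v \<tau> z s. v \<in> admissible_controls T U \<Longrightarrow> ode_solution f x0 T v \<tau> z \<Longrightarrow>
                   s \<in> {0..T} \<Longrightarrow> z s = x v \<tau> s"
    and times: "\<And>i. i \<in> {1..M} \<Longrightarrow> t i \<in> {0..T}"
    and weights: "\<And>i d. i \<in> {1..M} \<Longrightarrow> d \<in> {1..n_exp} \<Longrightarrow> w i d \<in> {0, 1}"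
    and control: "u \<in> admissible_controls T U"
    and meas: "\<And>i d. i \<in> {1..M} \<Longrightarrow> d \<in> {1..n_exp} \<Longrightarrow> w i d = 1 \<Longrightarrow>
                 (\<lambda>\<tau>. h d (x u \<tau> (t i))) \<in> borel_measurable borel"
    and "prob_space P"
    and prior: "\<And>\<tau>. 0 \<le> p0 \<tau>" "distributed P lborel \<theta> (\<lambda>\<tau>. ennreal (p0 \<tau>))"
    and noise: "\<And>i d v. i \<in> {1..M} \<Longrightarrow> d \<in> {1..n_exp} \<Longrightarrow> 0 \<le> p_noise i d v"
      "\<And>i d. i \<in> {1..M} \<Longrightarrow> d \<in> {1..n_exp} \<Longrightarrow>
         distributed P lborel (\<epsilon> i d) (\<lambda>v. ennreal (p_noise i d v))"
    and indep_noise: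
      "prob_space.indep_vars P (\<lambda>_. borel) (\<lambda>(i, d). \<epsilon> i d) ({1..M} \<times> {1..n_exp})"
    and indep_prior:
      "prob_space.indep_set P
         (sets (vimage_algebra (space P) \<theta> borel))
         (sets (vimage_algebra (space P) (\<lambda>\<omega>. \<lambda>(i, d)\<in>{1..M} \<times> {1..n_exp}. \<epsilon> i d \<omega>)
            (\<Pi>\<^sub>M k\<in>{1..M} \<times> {1..n_exp}. borel)))"
    and observations: "\<And>i d \<omega>. i \<in> {1..M} \<Longrightarrow> d \<in> {1..n_exp} \<Longrightarrow>
      y i d \<omega> = (if w i d = 1 then Some (h d (x u (\<theta> \<omega>) (t i)) + \<epsilon> i d \<omega>) else None)"
    and finite_inst: "\<And>i. i \<in> {1..M} \<Longrightarrow>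
      finite_I_inst p0 (block_space n_exp) (block_likelihood n_exp x h t p_noise w u i)"
    and finite_cond: "\<And>i. i \<in> {1..M} \<Longrightarrow>
      finite_conditional_mutual_information P borel (block_space n_exp) (history_space n_exp (i - 1))
        \<theta> (block n_exp y i) (history n_exp y (i - 1))"
    and finite_past: "\<And>i. i \<in> {1..M} \<Longrightarrow>
      finite_mutual_information P (block_space n_exp) (history_space n_exp (i - 1))
        (block n_exp y i) (history n_exp y (i - 1))"
    and finite_EIG:
      "finite_mutual_information P borel (history_space n_exp M) \<theta> (history n_exp y M)"
  shows "(\<forall>i\<in>{1..M}.
            I_inst p0 (block_space n_exp) (block_likelihood n_exp x h t p_noise w u i)
              - cond_mutual_info P borel (block_space n_exp) (history_space n_exp (i - 1))
                  \<theta> (block n_exp y i) (history n_exp y (i - 1))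
            = mutual_info P (block_space n_exp) (history_space n_exp (i - 1))
                (block n_exp y i) (history n_exp y (i - 1))
          \<and> 0 \<le> mutual_info P (block_space n_exp) (history_space n_exp (i - 1))
                (block n_exp y i) (history n_exp y (i - 1)))
       \<and> (\<forall>i\<in>{1..M}.
            cond_mutual_info P borel (block_space n_exp) (history_space n_exp (i - 1))
              \<theta> (block n_exp y i) (history n_exp y (i - 1))
            \<le> I_inst p0 (block_space n_exp) (block_likelihood n_exp x h t p_noise w u i))
       \<and> J_EIG P n_exp M \<theta> y
          \<le> J_inst p0 (block_space n_exp) M (block_likelihood n_exp x h t p_noise w u)"
proof -
  interpret sensor_experiment P p0 \<theta> M n_exp h x t u w p_noise \<epsilon>
  proof (intro sensor_experiment.intro bayes_prior.intro)
    show "prob_space P" by fact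
    show "bayes_prior_axioms P p0 \<theta>"
      using prior by unfold_locales
    show "sensor_experiment_axioms P \<theta> M n_exp h x t u w p_noise \<epsilon>"
      using meas noise indep_noise indep_prior by (intro sensor_experiment_axioms.intro)
  qed
  let ?B = "block_space n_exp :: (nat \<Rightarrow> (real ^ 'ny) option) measure"
  let ?H = "\<lambda>k. history_space n_exp k :: (nat \<Rightarrow> nat \<Rightarrow> (real ^ 'ny) option) measure"
  \<comment> \<open>\<open>observations\<close> prescribes \<open>y\<close> only for indices in
    range; both functions are restricted to that range, so they agree entirely.\<close>
  have block: "block n_exp y i = (\<lambda>\<omega>. obs_block (\<theta> \<omega>) (noise_vector \<omega>) i)" if "i \<in> {1..M}" for i
    using that unfolding block_def obs_block_def
    by (intro ext restrict_ext) (simp add: observations obs_def noise_vector_apply del: One_nat_def)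
  have history: "history n_exp y k = (\<lambda>\<omega>. obs_history k (\<theta> \<omega>) (noise_vector \<omega>))" if "k \<le> M" for k
    using that unfolding history_def obs_history_def
    by (intro ext restrict_ext) (simp add: block)
  have gap: "I_inst p0 ?B (likelihood i) - cond_mutual_info P borel ?B (?H (i - 1)) \<theta> (block n_exp y i) (history n_exp y (i - 1))
        = mutual_info P ?B (?H (i - 1)) (block n_exp y i) (history n_exp y (i - 1))"
    and nonneg: "0 \<le> mutual_info P ?B (?H (i - 1)) (block n_exp y i) (history n_exp y (i - 1))"
    if i: "i \<in> {1..M}" for i
  proof -
    have k: "i - 1 \<le> M"
      using i by auto
    note obs = observes_block[OF i] observes_history[OF k] observes_block_history[OF i]
    show "I_inst p0 ?B (likelihood i) - cond_mutual_info P borel ?B (?H (i - 1)) \<theta> (block n_exp y i) (history n_exp y (i - 1))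
        = mutual_info P ?B (?H (i - 1)) (block n_exp y i) (history n_exp y (i - 1))"
      using I_inst_minus_cond_mutual_info(1)[OF obs] finite_inst[OF i] finite_past[OF i] finite_cond[OF i]
      unfolding block[OF i] history[OF k] by blast
    show "0 \<le> mutual_info P ?B (?H (i - 1)) (block n_exp y i) (history n_exp y (i - 1))"
      using I_inst_minus_cond_mutual_info(2)[OF obs] finite_inst[OF i] finite_past[OF i] finite_cond[OF i]
      unfolding block[OF i] history[OF k] by blast
  qed
  have le: "cond_mutual_info P borel ?B (?H (i - 1)) \<theta> (block n_exp y i) (history n_exp y (i - 1)) \<le> I_inst p0 ?B (likelihood i)"
    if "i \<in> {1..M}" for i
    using gap[OF that] nonneg[OF that] by linarith
  \<comment> \<open>Chain rule: the sum telescopes from the empty history, which carries no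
    information, to the full one.\<close>
  have "J_EIG P n_exp M \<theta> y = (\<Sum>i = 1..M. cond_mutual_info P borel ?B (?H (i - 1)) \<theta> (block n_exp y i) (history n_exp y (i - 1)))"
    unfolding J_EIG_def history[OF order_refl] mutual_info_history_eq_sum[OF order_refl]
    by (intro sum.cong refl) (simp add: block history[OF le_trans[OF diff_le_self]] del: One_nat_def)
  also have "\<dots> \<le> J_inst p0 ?B M likelihood"
    unfolding J_inst_def by (rule sum_mono) (rule le)
  finally show ?thesis
    using gap nonneg le by blast
qed

end
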